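(* Let $\mathcal{G}$ be a finite stochastic game with vertex set $V$, let $\Omega_1:V\to\{0,1\}$ (a coBüchi condition) and $\Omega_2:V\to\mathbb{N}$. If Player 1 has a strategy from a vertex $v$ that is sure winning for $\mathsf{Parity}(\Omega_1)$ and almost-sure winning for $\mathsf{Parity}(\Omega_2)$, then Player 1 has a memoryless such strategy from $v$.
   Context: A stochastic game $\langle V,(V_1,V_2,V_\Diamond),E,\delta\rangle$ has a finite vertex set $V$ partitioned into Player-1, Player-2 and probabilistic vertices, edges $E\subseteq V\times V$ with every vertex having a successor, and $\delta:V_\Diamond\to\mathcal{D}(V)$ giving for each probabilistic vertex a distribution whose support is exactly its successor set. A strategy for Player $i$ maps histories (finite paths) ending in $V_i$ to a successor of the last vertex; it is memoryless if its choice depends only on the last vertex of the history. $\mathsf{Out}(v,\sigma_1)$ is the set of plays from $v$ consistent with $\sigma_1$, and $\mathsf{Pr}_v^{\sigma_1,\sigma_2}$ is the induced probability measure. $\mathsf{Parity}(\Omega)$ is the set of plays $v_0v_1\dots$ with $\limsup_j\Omega(v_j)$ even (for $\Omega$ into $\{0,1\}$ this means priority 1 is visited only finitely often). $\sigma_1$ is sure winning for $\psi$ from $v$ if $\mathsf{Out}(v,\sigma_1)\subseteq\psi$, and almost-sure winning if $\mathsf{Pr}_v^{\sigma_1,\sigma_2}(\psi)=1$ for all Player-2 strategies $\sigma_2$. *)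

theory Defs
  imports "HOL-Probability.Probability"
begin

text \<open>Finite stochastic games. The vertex set is the (finite) type 'v, i.e. V = UNIV.
  V1, V2, VP are the Player-1, Player-2 and probabilistic vertices, E the edges,
  and delta gives the distribution at probabilistic vertices.\<close>

definition stoch_game ::
  "'v::finite set \<Rightarrow> 'v set \<Rightarrow> 'v set \<Rightarrow> ('v \<times> 'v) set \<Rightarrow> ('v \<Rightarrow> 'v pmf) \<Rightarrow> bool" where
  "stoch_game V1 V2 VP E \<delta> \<longleftrightarrow>
     V1 \<union> V2 \<union> VP = UNIV \<and> V1 \<inter> V2 = {} \<and> V1 \<inter> VP = {} \<and> V2 \<inter> VP = {} \<and>
     (\<forall>v. \<exists>w. (v, w) \<in> E) \<and>
     (\<forall>v\<in>VP. set_pmf (\<delta> v) = {w. (v, w) \<in> E})"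

definition history :: "('v \<times> 'v) set \<Rightarrow> 'v list \<Rightarrow> bool" where
  "history E h \<longleftrightarrow> h \<noteq> [] \<and> (\<forall>i. Suc i < length h \<longrightarrow> (h ! i, h ! Suc i) \<in> E)"

definition strategy :: "('v \<times> 'v) set \<Rightarrow> 'v set \<Rightarrow> ('v list \<Rightarrow> 'v) \<Rightarrow> bool" where
  "strategy E Vi \<sigma> \<longleftrightarrow> (\<forall>h. history E h \<and> last h \<in> Vi \<longrightarrow> (last h, \<sigma> h) \<in> E)"

definition memoryless :: "('v \<times> 'v) set \<Rightarrow> 'v set \<Rightarrow> ('v list \<Rightarrow> 'v) \<Rightarrow> bool" where
  "memoryless E Vi \<sigma> \<longleftrightarrow>
     (\<forall>h h'. history E h \<and> history E h' \<and> last h \<in> Vi \<and> last h = last h' \<longrightarrow> \<sigma> h = \<sigma> h')"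

definition play :: "('v \<times> 'v) set \<Rightarrow> 'v stream \<Rightarrow> bool" where
  "play E \<omega> \<longleftrightarrow> (\<forall>i. (\<omega> !! i, \<omega> !! Suc i) \<in> E)"

definition Out :: "('v \<times> 'v) set \<Rightarrow> 'v set \<Rightarrow> 'v \<Rightarrow> ('v list \<Rightarrow> 'v) \<Rightarrow> 'v stream set" where
  "Out E V1 v \<sigma>1 = {\<omega>. play E \<omega> \<and> shd \<omega> = v \<and>
      (\<forall>n. \<omega> !! n \<in> V1 \<longrightarrow> \<omega> !! Suc n = \<sigma>1 (stake (Suc n) \<omega>))}"

definition Parity :: "('v \<Rightarrow> nat) \<Rightarrow> 'v stream set" where
  "Parity \<Omega> = {\<omega>. \<exists>n. limsup (\<lambda>j. enat (\<Omega> (\<omega> !! j))) = enat n \<and> even n}"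

definition step_prob ::
  "'v set \<Rightarrow> 'v set \<Rightarrow> ('v \<Rightarrow> 'v pmf) \<Rightarrow> ('v list \<Rightarrow> 'v) \<Rightarrow> ('v list \<Rightarrow> 'v) \<Rightarrow> 'v list \<Rightarrow> 'v \<Rightarrow> real" where
  "step_prob V1 V2 \<delta> \<sigma>1 \<sigma>2 h w =
     (if last h \<in> V1 then (if \<sigma>1 h = w then 1 else 0)
      else if last h \<in> V2 then (if \<sigma>2 h = w then 1 else 0)
      else pmf (\<delta> (last h)) w)"

definition cyl_prob ::
  "'v set \<Rightarrow> 'v set \<Rightarrow> ('v \<Rightarrow> 'v pmf) \<Rightarrow> ('v list \<Rightarrow> 'v) \<Rightarrow> ('v list \<Rightarrow> 'v) \<Rightarrow> 'v \<Rightarrow> 'v list \<Rightarrow> real" where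
  "cyl_prob V1 V2 \<delta> \<sigma>1 \<sigma>2 v xs =
     (if hd xs = v then 1 else 0) *
     (\<Prod>k<length xs - 1. step_prob V1 V2 \<delta> \<sigma>1 \<sigma>2 (take (Suc k) xs) (xs ! Suc k))"

text \<open>P is the probability measure Pr_v^{sigma1,sigma2} on plays (streams with the
  product sigma-algebra), characterised by its values on cylinder sets. Such a measure
  exists (Ionescu-Tulcea) and is unique.\<close>
definition is_Pr ::
  "'v set \<Rightarrow> 'v set \<Rightarrow> ('v \<Rightarrow> 'v pmf) \<Rightarrow> ('v list \<Rightarrow> 'v) \<Rightarrow> ('v list \<Rightarrow> 'v) \<Rightarrow> 'v \<Rightarrow> 'v stream measure \<Rightarrow> bool" where
  "is_Pr V1 V2 \<delta> \<sigma>1 \<sigma>2 v P \<longleftrightarrow>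
     prob_space P \<and> sets P = sets (stream_space (count_space UNIV)) \<and>
     (\<forall>xs. xs \<noteq> [] \<longrightarrow> emeasure P (sstart UNIV xs) = ennreal (cyl_prob V1 V2 \<delta> \<sigma>1 \<sigma>2 v xs))"

definition sure_winning ::
  "('v \<times> 'v) set \<Rightarrow> 'v set \<Rightarrow> 'v \<Rightarrow> ('v list \<Rightarrow> 'v) \<Rightarrow> 'v stream set \<Rightarrow> bool" where
  "sure_winning E V1 v \<sigma>1 \<psi> \<longleftrightarrow> Out E V1 v \<sigma>1 \<subseteq> \<psi>"

definition as_winning ::
  "'v set \<Rightarrow> 'v set \<Rightarrow> ('v \<times> 'v) set \<Rightarrow> ('v \<Rightarrow> 'v pmf) \<Rightarrow> 'v \<Rightarrow> ('v list \<Rightarrow> 'v) \<Rightarrow> 'v stream set \<Rightarrow> bool" where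
  "as_winning V1 V2 E \<delta> v \<sigma>1 \<psi> \<longleftrightarrow>
     (\<forall>\<sigma>2 P. strategy E V2 \<sigma>2 \<longrightarrow> is_Pr V1 V2 \<delta> \<sigma>1 \<sigma>2 v P \<longrightarrow> emeasure P \<psi> = 1)"

end

theory Submission
  imports Defs
begin

text \<open>
  Call a play fair if every random vertex that it visits infinitely often is infinitely often left
  along each of its edges. Under any pair of strategies almost every play is fair, so a
  memoryless strategy that wins all fair plays is almost-sure winning. A recursion in the style of
  Zielonka shows: if no nonempty set of vertices is won by one player by a memoryless strategy against
  all fair plays, then the other player wins all fair plays from everywhere by a memoryless strategy.

  Let \<open>X\<close> be a largest set on which a memoryless strategy surely wins the coBuchi condition and wins all
  fair plays for \<open>\<Omega>2\<close>, and suppose that a winning \<open>\<sigma>1\<close> starts outside of \<open>X\<close>. Some history that is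
  consistent with \<open>\<sigma>1\<close> and avoids \<open>X\<close> cannot be extended, still avoiding \<open>X\<close>, to a visit of priority 1:
  otherwise there would be a consistent play with infinitely many such visits. Let \<open>G\<close> be the set of
  vertices reached by the proper extensions of this history. If \<open>G\<close> is empty, \<open>X\<close> can be enlarged by the last vertex of the
  history. Otherwise either \<open>G\<close> can be added to \<open>X\<close>, or Player 2 wins all fair plays from
  some subset of \<open>G\<close>; but then it defeats \<open>\<sigma>1\<close> with positive probability by steering there.
\<close>

section \<open>Limiting priorities\<close>

text \<open>The limsup in elementary form: a value attained infinitely often that is eventually an
  upper bound. Plays are functions on \<open>nat\<close> here, so that passing to a tail is an index
  shift.\<close>

definition limit_priority :: "('v \<Rightarrow> nat) \<Rightarrow> (nat \<Rightarrow> 'v) \<Rightarrow> nat \<Rightarrow> bool" where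
  "limit_priority \<Omega> f p \<longleftrightarrow> (\<exists>\<^sub>\<infinity>n. \<Omega> (f n) = p) \<and> (\<forall>\<^sub>\<infinity>n. \<Omega> (f n) \<le> p)"

lemma limit_priority_unique:
  assumes "limit_priority \<Omega> f p" "limit_priority \<Omega> f q"
  shows "p = q"
proof -
  have *: "p \<le> q" if "limit_priority \<Omega> f p" "limit_priority \<Omega> f q" for p q
  proof -
    have "\<exists>\<^sub>\<infinity>n. \<Omega> (f n) = p \<and> \<Omega> (f n) \<le> q"
      using that unfolding limit_priority_def by (metis INFM_conjI)
    then show ?thesis by (auto dest: INFM_EX)
  qed
  show ?thesis using *[OF assms] *[OF assms(2,1)] by simp
qed

text \<open>Only finitely many priorities occur. By the pigeonhole principle one of them recurs, and
  those that do not recur have all died out from some point on, so the largest recurring one is the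
  limit.\<close>

lemma limit_priority_exists:
  fixes f :: "nat \<Rightarrow> 'v::finite"
  obtains p where "limit_priority \<Omega> f p"
proof -
  define I where "I = {q. \<exists>\<^sub>\<infinity>n. \<Omega> (f n) = q}"
  have sub: "I \<subseteq> range \<Omega>" unfolding I_def by (auto dest!: INFM_EX)
  then have fin: "finite I" by (rule finite_subset) simp
  have "\<exists>\<^sub>\<infinity>n. \<exists>q\<in>range \<Omega>. \<Omega> (f n) = q" by simp
  then have "\<exists>q\<in>range \<Omega>. \<exists>\<^sub>\<infinity>n. \<Omega> (f n) = q"
    by (subst (asm) INFM_finite_Bex_distrib) auto
  then have ne: "I \<noteq> {}" unfolding I_def by auto
  have "\<forall>\<^sub>\<infinity>n. \<forall>q\<in>range \<Omega> - I. \<Omega> (f n) \<noteq> q"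
    by (subst MOST_finite_Ball_distrib) (auto simp: I_def INFM_nat MOST_nat)
  then have "\<forall>\<^sub>\<infinity>n. \<Omega> (f n) \<le> Max I"
    by (rule MOST_mono) (use fin in \<open>auto intro: Max_ge\<close>)
  moreover have "\<exists>\<^sub>\<infinity>n. \<Omega> (f n) = Max I" using Max_in[OF fin ne] unfolding I_def by simp
  ultimately show ?thesis using that unfolding limit_priority_def by blast
qed

lemma limit_priority_limsup:
  assumes "limit_priority \<Omega> f p"
  shows "limsup (\<lambda>j. enat (\<Omega> (f j))) = enat p"
proof (rule antisym)
  show "limsup (\<lambda>j. enat (\<Omega> (f j))) \<le> enat p"
    using assms unfolding limit_priority_def
    by (intro Limsup_bounded) (auto simp: cofinite_eq_sequentially)
  show "enat p \<le> limsup (\<lambda>j. enat (\<Omega> (f j)))"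
  proof (rule ccontr)
    assume "\<not> ?thesis"
    then have "limsup (\<lambda>j. enat (\<Omega> (f j))) < enat p" by simp
    then have "eventually (\<lambda>j. enat (\<Omega> (f j)) < enat p) sequentially"
      by (rule Limsup_lessD)
    then have "\<forall>\<^sub>\<infinity>j. \<Omega> (f j) < p" by (simp add: cofinite_eq_sequentially)
    then have "\<exists>\<^sub>\<infinity>j. \<Omega> (f j) = p \<and> \<Omega> (f j) < p"
      using assms unfolding limit_priority_def by (metis INFM_conjI)
    then show False by (auto dest: INFM_EX)
  qed
qed

lemma Parity_iff_limit_priority:
  fixes \<omega> :: "'v::finite stream"
  shows "\<omega> \<in> Parity \<Omega> \<longleftrightarrow> (\<exists>p. even p \<and> limit_priority \<Omega> (snth \<omega>) p)"
proof -
  obtain p where p: "limit_priority \<Omega> (snth \<omega>) p" by (rule limit_priority_exists)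
  have "\<omega> \<in> Parity \<Omega> \<longleftrightarrow> even p" using limit_priority_limsup[OF p] by (simp add: Parity_def)
  also have "\<dots> \<longleftrightarrow> (\<exists>p. even p \<and> limit_priority \<Omega> (snth \<omega>) p)"
    using p limit_priority_unique[OF p] by blast
  finally show ?thesis .
qed

lemma limit_priority_shift:
  "limit_priority \<Omega> (\<lambda>n. f (n + k)) p \<longleftrightarrow> limit_priority \<Omega> f p"
proof -
  have "(\<forall>\<^sub>\<infinity>n. \<Omega> (f (n + k)) \<le> p) \<longleftrightarrow> (\<forall>\<^sub>\<infinity>n. \<Omega> (f n) \<le> p)"
    unfolding cofinite_eq_sequentially by (rule eventually_sequentially_seg)
  moreover have "(\<forall>\<^sub>\<infinity>n. \<Omega> (f (n + k)) \<noteq> p) \<longleftrightarrow> (\<forall>\<^sub>\<infinity>n. \<Omega> (f n) \<noteq> p)"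
    unfolding cofinite_eq_sequentially by (rule eventually_sequentially_seg)
  ultimately show ?thesis unfolding limit_priority_def frequently_def by simp
qed

section \<open>Fair games\<close>

text \<open>Replaces fixed point iterations: attractors and the final winning set are chosen of
  greatest cardinality.\<close>

lemma ex_max_card:
  fixes P :: "'a::finite set \<Rightarrow> bool"
  assumes "P A"
  shows "\<exists>B. P B \<and> (\<forall>C. P C \<longrightarrow> card C \<le> card B)"
proof (rule ex_has_greatest_nat[of P A card, OF assms])
  show "\<forall>C. P C \<longrightarrow> card C < Suc (card (UNIV :: 'a set))"
    by (simp add: card_mono less_Suc_eq_le)
qed

lemma INFM_Suc: "(\<exists>\<^sub>\<infinity>n. P (Suc n)) \<longleftrightarrow> (\<exists>\<^sub>\<infinity>n. P n)" for P :: "nat \<Rightarrow> bool"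
  using eventually_sequentially_Suc[of "\<lambda>n. \<not> P n"]
  by (simp add: cofinite_eq_sequentially frequently_def)

text \<open>The owner \<^term>\<open>True\<close> is Player 1. A subarena \<^term>\<open>G\<close> may discard edges of either
  player, but never an edge of a random vertex.\<close>

locale fair_game =
  fixes own :: "bool \<Rightarrow> 'v::finite set" and E :: "('v \<times> 'v) set" and \<Omega> :: "'v \<Rightarrow> nat"
  assumes own_disjoint: "own b \<inter> own (\<not> b) = {}"
begin

definition random :: "'v set" where
  "random = - (own True \<union> own False)"

lemma own_cases: "v \<in> own b \<or> v \<in> own (\<not> b) \<or> v \<in> random"
  by (cases b) (auto simp: random_def)

lemma random_not_own: "v \<in> random \<Longrightarrow> v \<notin> own b"
  by (cases b) (auto simp: random_def)

definition fair :: "(nat \<Rightarrow> 'v) \<Rightarrow> bool" where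
  "fair f \<longleftrightarrow> (\<forall>v w. v \<in> random \<longrightarrow> (v, w) \<in> E \<longrightarrow> (\<exists>\<^sub>\<infinity>n. f n = v) \<longrightarrow>
     (\<exists>\<^sub>\<infinity>n. f n = v \<and> f (Suc n) = w))"

definition win :: "bool \<Rightarrow> (nat \<Rightarrow> 'v) \<Rightarrow> bool" where
  "win b f \<longleftrightarrow> (\<exists>p. even p = b \<and> limit_priority \<Omega> f p)"

text \<open>Confinement to \<open>G\<close> is demanded of the play itself, so a play that happens
  to stay in a smaller set conforms there as well (\<open>conforms_cong\<close>).\<close>

definition conforms :: "bool \<Rightarrow> ('v \<Rightarrow> 'v) \<Rightarrow> 'v set \<Rightarrow> (nat \<Rightarrow> 'v) \<Rightarrow> bool" where
  "conforms b \<tau> G f \<longleftrightarrow>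
     (\<forall>n. f n \<in> G \<and> (f n, f (Suc n)) \<in> E \<and> (f n \<in> own b \<longrightarrow> f (Suc n) = \<tau> (f n)))"

definition arena :: "'v set \<Rightarrow> bool" where
  "arena G \<longleftrightarrow> (\<forall>v\<in>G. \<exists>w\<in>G. (v, w) \<in> E) \<and> (\<forall>v\<in>G \<inter> random. \<forall>w. (v, w) \<in> E \<longrightarrow> w \<in> G)"

text \<open>\<open>U\<close> is a trap: within \<open>G\<close> neither the opponent of
  \<open>b\<close> nor chance can leave it.\<close>

definition region :: "bool \<Rightarrow> 'v set \<Rightarrow> 'v set \<Rightarrow> ('v \<Rightarrow> 'v) \<Rightarrow> bool" where
  "region b G U \<tau> \<longleftrightarrow> U \<subseteq> G \<and> (\<forall>v\<in>U \<inter> own b. \<tau> v \<in> U \<and> (v, \<tau> v) \<in> E) \<and>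
     (\<forall>v\<in>U - own b. \<forall>w\<in>G. (v, w) \<in> E \<longrightarrow> w \<in> U) \<and>
     (\<forall>f. conforms b \<tau> U f \<longrightarrow> fair f \<longrightarrow> win b f)"

lemma fair_shift:
  assumes "fair f"
  shows "fair (\<lambda>n. f (n + k))"
proof -
  have *: "(\<exists>\<^sub>\<infinity>n. P (n + k)) \<longleftrightarrow> (\<exists>\<^sub>\<infinity>n. P n)" for P :: "nat \<Rightarrow> bool"
    by (simp add: cofinite_eq_sequentially frequently_def eventually_sequentially_seg[of "\<lambda>n. \<not> P n"])
  show ?thesis
    unfolding fair_def
  proof (intro allI impI)
    fix v w
    assume "v \<in> random" "(v, w) \<in> E" and inf: "\<exists>\<^sub>\<infinity>n. f (n + k) = v"
    then have "\<exists>\<^sub>\<infinity>n. f n = v \<and> f (Suc n) = w"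
      using assms *[of "\<lambda>n. f n = v"] unfolding fair_def by blast
    then show "\<exists>\<^sub>\<infinity>n. f (n + k) = v \<and> f (Suc n + k) = w"
      using *[of "\<lambda>n. f n = v \<and> f (Suc n) = w"] by simp
  qed
qed

lemma win_shift: "win b (\<lambda>n. f (n + k)) \<longleftrightarrow> win b f"
  by (simp add: win_def limit_priority_shift)

lemma not_win_both: "win b f \<Longrightarrow> \<not> win (\<not> b) f"
  unfolding win_def by (auto dest: limit_priority_unique)

section \<open>Attractors under fairness\<close>

text \<open>The attractor of \<open>D\<close> for \<open>b\<close>, with chance on the side of
  \<open>b\<close>. Instead of ranks, the definition records what attraction is used for: a fair
  play that returns to \<open>A\<close> forever also returns to \<open>D\<close> forever.\<close>

definition attracts :: "bool \<Rightarrow> 'v set \<Rightarrow> 'v set \<Rightarrow> 'v set \<Rightarrow> ('v \<Rightarrow> 'v) \<Rightarrow> bool" where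
  "attracts b G D A \<tau> \<longleftrightarrow> D \<subseteq> A \<and> A \<subseteq> G \<and>
     (\<forall>v\<in>(A - D) \<inter> own b. \<tau> v \<in> A \<and> (v, \<tau> v) \<in> E) \<and>
     (\<forall>f. (\<forall>n. f n \<in> G \<and> (f n, f (Suc n)) \<in> E) \<longrightarrow>
        (\<forall>n. f n \<in> (A - D) \<inter> own b \<longrightarrow> f (Suc n) = \<tau> (f n)) \<longrightarrow>
        fair f \<longrightarrow> (\<exists>\<^sub>\<infinity>n. f n \<in> A) \<longrightarrow> (\<exists>\<^sub>\<infinity>n. f n \<in> D))"

lemma attracts_subset: "attracts b G D A \<tau> \<Longrightarrow> D \<subseteq> A" "attracts b G D A \<tau> \<Longrightarrow> A \<subseteq> G"
  unfolding attracts_def by simp_all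

lemma attracts_infinitely_often:
  assumes "attracts b G D A \<tau>" "\<And>n. f n \<in> G" "\<And>n. (f n, f (Suc n)) \<in> E"
    and "\<And>n. f n \<in> (A - D) \<inter> own b \<Longrightarrow> f (Suc n) = \<tau> (f n)" "fair f" "\<exists>\<^sub>\<infinity>n. f n \<in> A"
  shows "\<exists>\<^sub>\<infinity>n. f n \<in> D"
proof -
  have "\<forall>n. f n \<in> G \<and> (f n, f (Suc n)) \<in> E"
    "\<forall>n. f n \<in> (A - D) \<inter> own b \<longrightarrow> f (Suc n) = \<tau> (f n)"
    using assms(2-4) by blast+
  then show ?thesis using assms(1,5,6) unfolding attracts_def by blast
qed

text \<open>A play that visits \<open>v\<close> infinitely often enters \<open>A\<close> infinitely
  often: \<open>b\<close> moves to \<open>w\<close>, the opponent has no other choice inside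
  \<open>G\<close>, and at a random \<open>v\<close> fairness takes the edge to \<open>w\<close>
  again and again.\<close>

lemma attracts_insert:
  assumes A: "attracts b G D A \<tau>" and v: "v \<in> G - A"
    and step: "v \<in> own (\<not> b) \<longrightarrow> (\<forall>w\<in>G. (v, w) \<in> E \<longrightarrow> w \<in> A)"
    and w: "v \<notin> own (\<not> b) \<longrightarrow> (v, w) \<in> E \<and> w \<in> A"
  shows "attracts b G D (insert v A) (\<tau>(v := w))"
proof -
  have sub: "D \<subseteq> A" "A \<subseteq> G" using A unfolding attracts_def by auto
  have "\<exists>\<^sub>\<infinity>n. f n \<in> D"
    if f: "\<forall>n. f n \<in> G \<and> (f n, f (Suc n)) \<in> E"
      and c: "\<forall>n. f n \<in> (insert v A - D) \<inter> own b \<longrightarrow> f (Suc n) = (\<tau>(v := w)) (f n)"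
      and "fair f" and inf: "\<exists>\<^sub>\<infinity>n. f n \<in> insert v A" for f
  proof -
    have c': "\<forall>n. f n \<in> (A - D) \<inter> own b \<longrightarrow> f (Suc n) = \<tau> (f n)"
      using c v by (metis DiffD2 DiffD1 DiffI IntD1 IntD2 IntI fun_upd_other insertCI)
    have "\<exists>\<^sub>\<infinity>n. f n \<in> A"
    proof (rule ccontr)
      assume no: "\<not> ?thesis"
      have "\<exists>\<^sub>\<infinity>n. f n = v \<or> f n \<in> A" using inf by simp
      then have infv: "\<exists>\<^sub>\<infinity>n. f n = v" using no by (simp add: INFM_disj_distrib)
      have "\<exists>\<^sub>\<infinity>n. f (Suc n) \<in> A"
      proof (cases "v \<in> random")
        case True
        then have "\<exists>\<^sub>\<infinity>n. f n = v \<and> f (Suc n) = w"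
          using \<open>fair f\<close> infv w random_not_own unfolding fair_def by blast
        then show ?thesis by (rule INFM_mono) (use w True random_not_own in auto)
      next
        case False
        have "f (Suc n) \<in> A" if "f n = v" for n
        proof (cases "v \<in> own b")
          case True
          then have "v \<notin> own (\<not> b)" using own_disjoint by auto
          then show ?thesis using c v w True that sub by auto
        next
          case F: False
          then have "v \<in> own (\<not> b)" using False own_cases by blast
          then show ?thesis using step f that by metis
        qed
        then show ?thesis using infv by (auto elim: INFM_mono)
      qed
      then show False using no INFM_Suc[of "\<lambda>n. f n \<in> A"] by simp
    qed
    then show ?thesis using A f c' \<open>fair f\<close> unfolding attracts_def by blast
  qed
  moreover have "(\<tau>(v := w)) u \<in> insert v A \<and> (u, (\<tau>(v := w)) u) \<in> E"
    if "u \<in> (insert v A - D) \<inter> own b" for u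
  proof (cases "u = v")
    case True
    then have "v \<notin> own (\<not> b)" using own_disjoint that by auto
    then show ?thesis using w True by simp
  next
    case False
    then show ?thesis using that A unfolding attracts_def by auto
  qed
  moreover have "D \<subseteq> insert v A" "insert v A \<subseteq> G" using sub v by auto
  ultimately show ?thesis unfolding attracts_def by (intro conjI ballI allI impI) simp_all
qed

text \<open>A largest attracted set cannot be enlarged by \<open>attracts_insert\<close>. Hence
  outside of it only the opponent of \<open>b\<close> can have edges into it, and the opponent
  always has an alternative, so the remainder has no dead ends.\<close>

lemma attractor_exists:
  assumes "D \<subseteq> G" and succ: "\<forall>v\<in>G - D. \<exists>w\<in>G. (v, w) \<in> E"
  obtains A \<tau> where "attracts b G D A \<tau>"
    and "\<forall>v\<in>G - A. v \<notin> own (\<not> b) \<longrightarrow> (\<forall>w\<in>A. (v, w) \<notin> E)"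
    and "\<forall>v\<in>G - A. \<exists>w\<in>G - A. (v, w) \<in> E"
proof -
  define P where "P A \<longleftrightarrow> (\<exists>\<tau>. attracts b G D A \<tau>)" for A
  have "P D" using assms(1) unfolding P_def attracts_def by auto
  then obtain A where "P A" and max: "\<And>B. P B \<Longrightarrow> card B \<le> card A"
    using ex_max_card[of P D] by blast
  then obtain \<tau> where A: "attracts b G D A \<tau>" unfolding P_def by auto
  have no: False if "v \<in> G - A" and "v \<in> own (\<not> b) \<longrightarrow> (\<forall>w\<in>G. (v, w) \<in> E \<longrightarrow> w \<in> A)"
    and "v \<notin> own (\<not> b) \<longrightarrow> (v, w) \<in> E \<and> w \<in> A" for v w
  proof -
    have "P (insert v A)" using attracts_insert[OF A that] unfolding P_def by auto
    then show False using max[of "insert v A"] that(1) by simp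
  qed
  have 1: "\<forall>v\<in>G - A. v \<notin> own (\<not> b) \<longrightarrow> (\<forall>w\<in>A. (v, w) \<notin> E)" using no by blast
  have "\<exists>w\<in>G - A. (v, w) \<in> E" if v: "v \<in> G - A" for v
  proof (cases "v \<in> own (\<not> b)")
    case True
    then show ?thesis using no[OF v] by blast
  next
    case False
    have "D \<subseteq> A" using A unfolding attracts_def by auto
    then show ?thesis using 1 succ v False by blast
  qed
  then show ?thesis using that[OF A 1] by blast
qed

section \<open>Composing winning regions\<close>

lemma conformsD:
  assumes "conforms b \<tau> G f"
  shows "f n \<in> G" "(f n, f (Suc n)) \<in> E" "f n \<in> own b \<Longrightarrow> f (Suc n) = \<tau> (f n)"
  using assms unfolding conforms_def by blast+

lemma conforms_shift: "conforms b \<tau> G f \<Longrightarrow> conforms b \<tau> G (\<lambda>n. f (n + k))"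
  using conformsD[of b \<tau> G f] unfolding conforms_def[of _ _ _ "\<lambda>n. f (n + k)"] add_Suc by blast

lemma conforms_cong:
  assumes f: "conforms b \<tau> G f" and U: "\<And>n. f n \<in> U"
    and eq: "\<And>v. v \<in> U \<inter> own b \<Longrightarrow> \<tau> v = \<tau>' v"
  shows "conforms b \<tau>' U f"
  unfolding conforms_def
proof (intro allI conjI impI)
  fix n
  show "f n \<in> U" "(f n, f (Suc n)) \<in> E" using U conformsD(2)[OF f] by auto
  show "f (Suc n) = \<tau>' (f n)" if "f n \<in> own b"
    using conformsD(3)[OF f that] eq[of "f n"] U that by simp
qed

text \<open>Outside the attractor only the opponent of \<^term>\<open>b\<close> can move into it, so what the
  opponent wins there it also wins in the whole arena.\<close>

lemma region_lift:
  assumes "region (\<not> b) (G - A) U \<tau>"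
    and "\<forall>v\<in>G - A. v \<notin> own (\<not> b) \<longrightarrow> (\<forall>w\<in>A. (v, w) \<notin> E)"
  shows "region (\<not> b) G U \<tau>"
proof -
  have "U \<subseteq> G - A" and "\<forall>v\<in>U - own (\<not> b). \<forall>w\<in>G - A. (v, w) \<in> E \<longrightarrow> w \<in> U"
    using assms(1) unfolding region_def by simp_all
  then have "U \<subseteq> G" "\<forall>v\<in>U - own (\<not> b). \<forall>w\<in>G. (v, w) \<in> E \<longrightarrow> w \<in> U"
    using assms(2) by blast+
  then show ?thesis using assms(1) unfolding region_def by simp
qed

text \<open>A random vertex outside \<open>A\<close> keeps all its edges: they stay in
  \<open>G\<close> because \<open>G\<close> is an arena, and none of them enters
  \<open>A\<close>.\<close>

lemma arena_diff:
  assumes "arena G" "\<forall>v\<in>G - A. v \<notin> own (\<not> b) \<longrightarrow> (\<forall>w\<in>A. (v, w) \<notin> E)"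
    and "\<forall>v\<in>G - A. \<exists>w\<in>G - A. (v, w) \<in> E"
  shows "arena (G - A)"
proof -
  have "w \<in> G - A" if "v \<in> (G - A) \<inter> random" "(v, w) \<in> E" for v w
    using assms(1,2) that random_not_own[of v "\<not> b"] unfolding arena_def by auto
  then have "\<forall>v\<in>(G - A) \<inter> random. \<forall>w. (v, w) \<in> E \<longrightarrow> w \<in> G - A" by blast
  then show ?thesis using assms(3) unfolding arena_def by (intro conjI)
qed

text \<open>A fair play that returns to \<open>A\<close> forever is drawn to \<open>D\<close>
  infinitely often, where the last hypothesis decides it. Any other play has a tail in
  \<open>G - A\<close>, which is won by \<open>\<tau>H\<close>, and winning does not depend on a
  finite prefix.\<close>

lemma region_combine:
  assumes A: "attracts b G D A \<tau>A" and H: "region b (G - A) (G - A) \<tau>H"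
    and \<tau>D: "\<forall>v\<in>D \<inter> own b. \<tau>D v \<in> G \<and> (v, \<tau>D v) \<in> E"
    and D: "\<And>f. conforms b (\<lambda>v. if v \<in> D then \<tau>D v else if v \<in> A then \<tau>A v else \<tau>H v) G f
              \<Longrightarrow> fair f \<Longrightarrow> \<exists>\<^sub>\<infinity>n. f n \<in> D \<Longrightarrow> win b f"
  shows "region b G G (\<lambda>v. if v \<in> D then \<tau>D v else if v \<in> A then \<tau>A v else \<tau>H v)"
    (is "region b G G ?\<tau>")
proof -
  have sub: "D \<subseteq> A" "A \<subseteq> G" using A unfolding attracts_def by auto
  have "win b f" if f: "conforms b ?\<tau> G f" "fair f" for f
  proof (cases "\<exists>\<^sub>\<infinity>n. f n \<in> A")
    case True
    have "\<exists>\<^sub>\<infinity>n. f n \<in> D"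
      by (rule attracts_infinitely_often[OF A conformsD(1,2)[OF f(1)] _ f(2) True])
        (use conformsD(3)[OF f(1)] in auto)
    then show ?thesis using D f by blast
  next
    case False
    then obtain k where k: "\<And>n. n \<ge> k \<Longrightarrow> f n \<notin> A" by (auto simp: INFM_nat_le)
    have "conforms b \<tau>H (G - A) (\<lambda>n. f (n + k))"
      by (rule conforms_cong[OF conforms_shift[OF f(1)]])
        (use k f(1) sub in \<open>auto simp: conforms_def\<close>)
    then have "win b (\<lambda>n. f (n + k))" using H fair_shift[OF f(2)] unfolding region_def by blast
    then show ?thesis by (simp add: win_shift)
  qed
  moreover have "\<forall>v\<in>G \<inter> own b. ?\<tau> v \<in> G \<and> (v, ?\<tau> v) \<in> E"
    using A H \<tau>D sub unfolding attracts_def region_def by auto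
  ultimately show ?thesis unfolding region_def by blast
qed

lemma region_combine_top:
  assumes G: "arena G" and A: "attracts b G D A \<tau>A" and H: "region b (G - A) (G - A) \<tau>H"
    and d: "even d = b" and top: "\<forall>v\<in>G. \<Omega> v \<le> d" and D: "D = {v \<in> G. \<Omega> v = d}"
  shows "\<exists>\<tau>. region b G G \<tau>"
proof -
  have "\<forall>v\<in>G. \<exists>w. w \<in> G \<and> (v, w) \<in> E" using G unfolding arena_def by blast
  \<comment> \<open>On the vertices of top priority any move inside \<open>G\<close> will do, since
    seeing them infinitely often already wins for \<open>b\<close>.\<close>
  from bchoice[OF this] obtain s where s: "\<forall>v\<in>G. s v \<in> G \<and> (v, s v) \<in> E" ..
  have "win b f" if "conforms b \<tau> G f" "\<exists>\<^sub>\<infinity>n. f n \<in> D" for f \<tau>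
  proof -
    have "\<exists>\<^sub>\<infinity>n. \<Omega> (f n) = d" by (rule INFM_mono[OF that(2)]) (simp add: D)
    moreover have "\<forall>\<^sub>\<infinity>n. \<Omega> (f n) \<le> d" using conformsD(1)[OF that(1)] top by simp
    ultimately have "limit_priority \<Omega> f d" unfolding limit_priority_def ..
    then show ?thesis using d unfolding win_def by blast
  qed
  then have "region b G G (\<lambda>v. if v \<in> D then s v else if v \<in> A then \<tau>A v else \<tau>H v)"
    by (intro region_combine[OF A H]) (use s D in auto)
  then show ?thesis by blast
qed

lemma region_stays:
  assumes "region b G U \<tau>" "conforms b \<tau>' G f" "\<And>v. v \<in> U \<inter> own b \<Longrightarrow> \<tau>' v = \<tau> v" "f k \<in> U"
  shows "f (n + k) \<in> U"
proof (induction n)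
  case (Suc n)
  have f: "f (Suc (n + k)) \<in> G" "(f (n + k), f (Suc (n + k))) \<in> E"
    "f (n + k) \<in> own b \<Longrightarrow> f (Suc (n + k)) = \<tau>' (f (n + k))"
    using conformsD[OF assms(2)] by auto
  show ?case
  proof (cases "f (n + k) \<in> own b")
    case True
    then show ?thesis using f(3) Suc assms(1,3) unfolding region_def by simp
  next
    case False
    then have "f (Suc (n + k)) \<in> U" using f(1,2) Suc assms(1) unfolding region_def by blast
    then show ?thesis by simp
  qed
qed (simp add: assms(4))

text \<open>Zielonka's recursion. In the last case the attractor of the opponent's region \<^term>\<open>U\<close>
  is removed, and a fair play that returns to it forever is trapped in \<^term>\<open>U\<close>.\<close>

theorem region_dichotomy:
  assumes "arena G" "\<And>U \<tau>. region b G U \<tau> \<Longrightarrow> U = {}"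
  shows "\<exists>\<tau>. region (\<not> b) G G \<tau>"
  using assms
proof (induction "card G" arbitrary: G b rule: less_induct)
  case less
  note G = less.prems(1)
  show ?case
  proof (cases "G = {}")
    case True
    then show ?thesis unfolding region_def conforms_def by auto
  next
    case False
    define d where "d = Max (\<Omega> ` G)"
    define D where "D = {v \<in> G. \<Omega> v = d}"
    have top: "\<forall>v\<in>G. \<Omega> v \<le> d" unfolding d_def by simp
    have "d \<in> \<Omega> ` G" unfolding d_def using False by (intro Max_in) auto
    then have D: "D \<noteq> {}" "D \<subseteq> G" unfolding D_def by auto
    have succ: "\<forall>v\<in>G - C. \<exists>w\<in>G. (v, w) \<in> E" for C using G unfolding arena_def by auto
    have smaller: "card (G - A) < card G" if "attracts c G C A \<tau>" "C \<noteq> {}" for c C A \<tau>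
      by (rule psubset_card_mono) (use that attracts_subset[OF that(1)] in auto)
    show ?thesis
    proof (cases "even d = b")
      case False
      \<comment> \<open>The top priority favours the opponent, who attracts to \<open>D\<close>. A
        region of \<open>b\<close> in the remainder would lift to \<open>G\<close>, so the recursion
        gives the whole remainder to the opponent.\<close>
      then have d: "even d = (\<not> b)" by simp
      obtain A \<tau>A where A: "attracts (\<not> b) G D A \<tau>A"
        and out: "\<forall>v\<in>G - A. v \<notin> own (\<not> \<not> b) \<longrightarrow> (\<forall>w\<in>A. (v, w) \<notin> E)"
        and ser: "\<forall>v\<in>G - A. \<exists>w\<in>G - A. (v, w) \<in> E"
        using attractor_exists[OF D(2) succ] by blast
      have "region b G U \<tau>" if "region b (G - A) U \<tau>" for U \<tau>
        using region_lift[OF _ out] that by simp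
      then have "\<exists>\<tau>. region (\<not> b) (G - A) (G - A) \<tau>"
        by (intro less.hyps[OF smaller[OF A D(1)] arena_diff[OF G out ser]] less.prems(2))
      then obtain \<tau>H where "region (\<not> b) (G - A) (G - A) \<tau>H" ..
      then show ?thesis by (rule region_combine_top[OF G A _ d top D_def])
    next
      case d: True
      obtain A \<tau>A where A: "attracts b G D A \<tau>A"
        and out: "\<forall>v\<in>G - A. v \<notin> own (\<not> b) \<longrightarrow> (\<forall>w\<in>A. (v, w) \<notin> E)"
        and ser: "\<forall>v\<in>G - A. \<exists>w\<in>G - A. (v, w) \<in> E"
        using attractor_exists[OF D(2) succ] by blast
      \<comment> \<open>The top priority favours \<open>b\<close>. If the opponent had no region in
        the remainder, the recursion with exchanged roles would give the remainder, and then all of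
        \<open>G\<close>, to \<open>b\<close>.\<close>
      have "\<exists>U \<tau>. region (\<not> b) (G - A) U \<tau> \<and> U \<noteq> {}"
      proof (rule ccontr)
        assume "\<not> ?thesis"
        then have "\<exists>\<tau>. region (\<not> \<not> b) (G - A) (G - A) \<tau>"
          by (intro less.hyps[OF smaller[OF A D(1)] arena_diff[OF G out ser]]) blast
        then obtain \<tau>H where H: "region b (G - A) (G - A) \<tau>H" by auto
        obtain \<tau> where "region b G G \<tau>" using region_combine_top[OF G A H d top D_def] ..
        then have "G = {}" by (rule less.prems(2))
        then show False using \<open>G \<noteq> {}\<close> by simp
      qed
      then obtain U \<tau>U where U: "region (\<not> b) G U \<tau>U" "U \<noteq> {}"
        using region_lift[OF _ out] by iprover
      then have "U \<subseteq> G" unfolding region_def by simp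
      then obtain B \<tau>B where B: "attracts (\<not> b) G U B \<tau>B"
        and outB: "\<forall>v\<in>G - B. v \<notin> own (\<not> \<not> b) \<longrightarrow> (\<forall>w\<in>B. (v, w) \<notin> E)"
        and serB: "\<forall>v\<in>G - B. \<exists>w\<in>G - B. (v, w) \<in> E"
        using attractor_exists[OF _ succ] by blast
      have "region b G U \<tau>" if "region b (G - B) U \<tau>" for U \<tau>
        using region_lift[OF _ outB] that by simp
      then have "\<exists>\<tau>. region (\<not> b) (G - B) (G - B) \<tau>"
        by (intro less.hyps[OF smaller[OF B U(2)] arena_diff[OF G outB serB]] less.prems(2))
      then obtain \<tau>H where H: "region (\<not> b) (G - B) (G - B) \<tau>H" ..
      let ?\<tau> = "\<lambda>v. if v \<in> U then \<tau>U v else if v \<in> B then \<tau>B v else \<tau>H v"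
      have "win (\<not> b) f"
        if f: "conforms (\<not> b) ?\<tau> G f" "fair f" and inf: "\<exists>\<^sub>\<infinity>n. f n \<in> U" for f
      proof -
        obtain k where k: "f k \<in> U" using inf by (auto dest: INFM_EX)
        have "f (n + k) \<in> U" for n by (rule region_stays[OF U(1) f(1) _ k]) simp
        then have "conforms (\<not> b) \<tau>U U (\<lambda>n. f (n + k))"
          by (intro conforms_cong[OF conforms_shift[OF f(1)]]) auto
        then have "win (\<not> b) (\<lambda>n. f (n + k))"
          using U(1) fair_shift[OF f(2)] unfolding region_def by simp
        then show ?thesis by (simp add: win_shift)
      qed
      then have "region (\<not> b) G G ?\<tau>"
        by (intro region_combine[OF B H])
          (use U(1) in \<open>auto simp: region_def\<close>)
      then show ?thesis by blast
    qed
  qed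
qed

text \<open>\<^term>\<open>T\<close> is an absorbing target for Player 1: away from the vertices from which it can be
  reached with positive probability, the dichotomy applies.\<close>

lemma region_or_opponent_region:
  assumes TG: "T \<inter> G = {}" and succ: "\<forall>v\<in>G. \<exists>w\<in>G \<union> T. (v, w) \<in> E"
    and closed: "\<forall>v\<in>G - own True. \<forall>w. (v, w) \<in> E \<longrightarrow> w \<in> G \<union> T"
  shows "(\<exists>\<tau>. (\<forall>v\<in>G \<inter> own True. \<tau> v \<in> G \<union> T \<and> (v, \<tau> v) \<in> E) \<and>
            (\<forall>f. conforms True \<tau> G f \<longrightarrow> fair f \<longrightarrow> win True f)) \<or>
         (\<exists>U \<tau>. U \<noteq> {} \<and> region False (G \<union> T) U \<tau> \<and> U \<subseteq> G)"
proof -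
  obtain A \<tau>A where A: "attracts True (G \<union> T) T A \<tau>A"
    and out: "\<forall>v\<in>(G \<union> T) - A. v \<notin> own (\<not> True) \<longrightarrow> (\<forall>w\<in>A. (v, w) \<notin> E)"
    and ser: "\<forall>v\<in>(G \<union> T) - A. \<exists>w\<in>(G \<union> T) - A. (v, w) \<in> E"
    using attractor_exists[of T "G \<union> T" True] succ by blast
  let ?H = "(G \<union> T) - A"
  have TA: "T \<subseteq> A" "A \<subseteq> G \<union> T" using A unfolding attracts_def by auto
  \<comment> \<open>Edges of random vertices stay in \<open>G \<union> T\<close> by
    \<open>closed\<close>, and by \<open>out\<close> they do not enter \<open>A\<close>.\<close>
  have arena: "arena ?H"
    using ser out closed random_not_own TA unfolding arena_def by blast
  show ?thesis
  proof (cases "\<exists>U \<tau>. region False ?H U \<tau> \<and> U \<noteq> {}")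
    case True
    then obtain U \<tau> where U: "region False ?H U \<tau>" "U \<noteq> {}" by blast
    have "U \<subseteq> G" using U(1) TA unfolding region_def by auto
    moreover have "region False (G \<union> T) U \<tau>" using region_lift[of True, OF _ out] U(1) by simp
    ultimately show ?thesis using U(2) by blast
  next
    case False
    then obtain \<tau>H where H: "region True ?H ?H \<tau>H"
      using region_dichotomy[OF arena, of False] by auto
    let ?\<tau> = "\<lambda>v. if v \<in> A then \<tau>A v else \<tau>H v"
    have "win True f" if f: "conforms True ?\<tau> G f" "fair f" for f
    proof -
      \<comment> \<open>A play confined to \<open>G\<close> never meets \<open>T\<close>. By
        attraction it can then visit \<open>A\<close> only finitely often, so its tail lies in
        \<open>?H\<close>, where \<open>\<tau>H\<close> wins.\<close>
      have notT: "\<not> (\<exists>\<^sub>\<infinity>n. f n \<in> T)"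
      proof
        assume "\<exists>\<^sub>\<infinity>n. f n \<in> T"
        then obtain n where "f n \<in> T" using INFM_EX by blast
        then show False using conformsD(1)[OF f(1), of n] TG by blast
      qed
      have "\<not> (\<exists>\<^sub>\<infinity>n. f n \<in> A)"
      proof
        assume "\<exists>\<^sub>\<infinity>n. f n \<in> A"
        then have "\<exists>\<^sub>\<infinity>n. f n \<in> T"
          by (intro attracts_infinitely_often[OF A _ conformsD(2)[OF f(1)] _ f(2)])
            (use conformsD(1,3)[OF f(1)] in auto)
        then show False using notT by simp
      qed
      then obtain k where k: "\<And>n. n \<ge> k \<Longrightarrow> f n \<notin> A" by (auto simp: INFM_nat_le)
      have "conforms True \<tau>H ?H (\<lambda>n. f (n + k))"
        by (rule conforms_cong[OF conforms_shift[OF f(1)]])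
          (use k f(1) in \<open>auto simp: conforms_def\<close>)
      then have "win True (\<lambda>n. f (n + k))"
        using H fair_shift[OF f(2)] unfolding region_def by blast
      then show ?thesis by (simp add: win_shift)
    qed
    moreover have "\<forall>v\<in>G \<inter> own True. ?\<tau> v \<in> G \<union> T \<and> (v, ?\<tau> v) \<in> E"
      using A H TG unfolding attracts_def region_def by auto
    ultimately show ?thesis
      by (intro disjI1 exI[of _ ?\<tau>] conjI allI impI) simp_all
  qed
qed

end

section \<open>The measure on plays\<close>

text \<open>Continuation of the history \<open>h\<close>, which is itself not emitted.
  \<open>N\<close> computes the next vertex from the current history and one element of the random
  stream.\<close>

primcorec run :: "('v list \<Rightarrow> ('v \<Rightarrow> 'v) \<Rightarrow> 'v) \<Rightarrow> 'v list \<Rightarrow> ('v \<Rightarrow> 'v) stream \<Rightarrow> 'v stream" where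
  "shd (run N h s) = N h (shd s)"
| "stl (run N h s) = run N (h @ [N h (shd s)]) (stl s)"

lemma run_Stream: "run N h (t ## s) = N h t ## run N (h @ [N h t]) s"
  by (subst run.ctr) simp

lemma run_snth: "run N h s !! n = N (h @ stake n (run N h s)) (s !! n)"
  by (induction n arbitrary: h s) simp_all

text \<open>All random choices are read off a stream of independent successor functions, so the measure
  on plays is the image of an i.i.d. stream measure; the first-step recursion of the latter yields the cylinder
  probabilities and the almost sure fairness.\<close>

locale play_measure =
  fixes V1 V2 :: "'v::finite set" and \<delta> :: "'v \<Rightarrow> 'v pmf" and \<sigma>1 \<sigma>2 :: "'v list \<Rightarrow> 'v"
begin

definition step :: "'v list \<Rightarrow> ('v \<Rightarrow> 'v) \<Rightarrow> 'v" where
  "step h \<xi> = (if last h \<in> V1 then \<sigma>1 h else if last h \<in> V2 then \<sigma>2 h else \<xi> (last h))"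

definition seed :: "('v \<Rightarrow> 'v) measure" where
  "seed = measure_pmf (Pi_pmf UNIV undefined \<delta>)"

definition seeds :: "('v \<Rightarrow> 'v) stream measure" where
  "seeds = stream_space seed"

sublocale seed: prob_space seed
  unfolding seed_def by (rule measure_pmf.prob_space_axioms)

sublocale seeds: prob_space seeds
  unfolding seeds_def by (rule seed.prob_space_stream_space)

lemma sets_seed [measurable_cong]: "sets seed = sets (count_space UNIV)"
  by (simp add: seed_def)

lemma space_seed [simp]: "space seed = UNIV"
  by (simp add: seed_def)

lemma sets_seeds [measurable_cong]: "sets seeds = sets (stream_space (count_space UNIV))"
  unfolding seeds_def by (rule sets_stream_space_cong) (rule sets_seed)

lemma space_seeds [simp]: "space seeds = UNIV"
  by (simp add: seeds_def space_stream_space)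

lemma emeasure_seed_step: "emeasure seed {\<xi>. step h \<xi> = a} = ennreal (step_prob V1 V2 \<delta> \<sigma>1 \<sigma>2 h a)"
proof (cases "last h \<in> V1 \<or> last h \<in> V2")
  case True
  have "emeasure seed UNIV = 1" using seed.emeasure_space_1 by simp
  then show ?thesis using True by (auto simp: step_def step_prob_def)
next
  case False
  then have "{\<xi>. step h \<xi> = a} = (\<lambda>\<xi>. \<xi> (last h)) -` {a}" by (auto simp: step_def)
  then have "emeasure seed {\<xi>. step h \<xi> = a} =
      emeasure (measure_pmf (map_pmf (\<lambda>\<xi>. \<xi> (last h)) (Pi_pmf UNIV undefined \<delta>))) {a}"
    by (simp add: seed_def)
  also have "\<dots> = ennreal (pmf (\<delta> (last h)) a)"
    by (subst Pi_pmf_component) (simp_all add: emeasure_pmf_single)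
  finally show ?thesis using False by (simp add: step_prob_def)
qed

text \<open>There are only countably many seeds, so measurability can be checked separately for each
  value of the first one.\<close>

lemma measurable_run_snth: "(\<lambda>s. run step h s !! n) \<in> measurable seeds (count_space UNIV)"
proof (induction n arbitrary: h)
  case 0
  show ?case by simp
next
  case (Suc n)
  have "(\<lambda>s. run step (h @ [step h \<xi>]) (stl s) !! n) \<in> measurable seeds (count_space UNIV)" for \<xi>
    by (rule measurable_compose[OF _ Suc]) measurable
  then have "(\<lambda>s. run step (h @ [step h (shd s)]) (stl s) !! n) \<in> measurable seeds (count_space UNIV)"
    by (rule measurable_compose_countable[where g = shd and
          f = "\<lambda>\<xi> s. run step (h @ [step h \<xi>]) (stl s) !! n"]) measurable
  then show ?case by simp
qed

lemma measurable_run [measurable]: "run step h \<in> measurable seeds (stream_space (count_space UNIV))"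
  by (rule measurable_stream_space2) (rule measurable_run_snth)

lemma emeasure_seeds:
  assumes "Measurable.pred seeds P"
  shows "emeasure seeds {s. P s} = (\<integral>\<^sup>+t. emeasure seeds {s. P (t ## s)} \<partial>seed)"
proof -
  have "{s. P s} \<in> sets (stream_space seed)"
    using assms unfolding seeds_def pred_def by (simp add: space_stream_space)
  from seed.emeasure_stream_space[OF this] show ?thesis
    by (simp add: seeds_def space_stream_space)
qed

lemma emeasure_run_sstart:
  "emeasure seeds {s. run step h s \<in> sstart UNIV xs} =
     ennreal (\<Prod>k<length xs. step_prob V1 V2 \<delta> \<sigma>1 \<sigma>2 (h @ take k xs) (xs ! k))"
proof (induction xs arbitrary: h)
  case Nil
  show ?case using seeds.emeasure_space_1 by simp
next
  case (Cons a xs)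
  define c where "c = (\<Prod>k<length xs. step_prob V1 V2 \<delta> \<sigma>1 \<sigma>2 (h @ a # take k xs) (xs ! k))"
  have sp: "0 \<le> step_prob V1 V2 \<delta> \<sigma>1 \<sigma>2 h a" for h a by (simp add: step_prob_def)
  then have c: "0 \<le> c" unfolding c_def by (intro prod_nonneg) auto
  note sstart_sets[measurable]
  have "emeasure seeds {s. run step h s \<in> sstart UNIV (a # xs)} =
      (\<integral>\<^sup>+t. emeasure seeds {s. run step h (t ## s) \<in> sstart UNIV (a # xs)} \<partial>seed)"
    by (rule emeasure_seeds) measurable
  \<comment> \<open>If the first move is not \<open>a\<close>, the cylinder is missed. Otherwise the
    rest is a run from \<open>h @ [a]\<close>, and the induction hypothesis gives
    \<open>c\<close>.\<close>
  also have "\<dots> = (\<integral>\<^sup>+t. ennreal c * indicator {t. step h t = a} t \<partial>seed)"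
  proof (rule nn_integral_cong)
    fix t
    show "emeasure seeds {s. run step h (t ## s) \<in> sstart UNIV (a # xs)} =
      ennreal c * indicator {t. step h t = a} t"
      using Cons[of "h @ [a]"] by (cases "step h t = a") (simp_all add: run_Stream c_def)
  qed
  also have "\<dots> = ennreal c * emeasure seed {t. step h t = a}"
    by (rule nn_integral_cmult_indicator) (simp add: sets_seed)
  also have "\<dots> = ennreal (step_prob V1 V2 \<delta> \<sigma>1 \<sigma>2 h a * c)"
    using sp c by (simp add: emeasure_seed_step ennreal_mult mult.commute)
  also have "step_prob V1 V2 \<delta> \<sigma>1 \<sigma>2 h a * c =
      (\<Prod>k<length (a # xs). step_prob V1 V2 \<delta> \<sigma>1 \<sigma>2 (h @ take k (a # xs)) ((a # xs) ! k))"
    by (simp only: list.size add_0_right add_Suc_right prod.lessThan_Suc_shift) (simp add: c_def)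
  finally show ?case .
qed

definition Pr :: "'v \<Rightarrow> 'v stream measure" where
  "Pr v = distr seeds (stream_space (count_space UNIV)) (\<lambda>s. v ## run step [v] s)"

lemma is_Pr_Pr: "is_Pr V1 V2 \<delta> \<sigma>1 \<sigma>2 v (Pr v)"
  unfolding is_Pr_def
proof (intro conjI allI impI)
  show "prob_space (Pr v)" unfolding Pr_def by (rule seeds.prob_space_distr) measurable
  show "sets (Pr v) = sets (stream_space (count_space UNIV))" by (simp add: Pr_def)
  fix xs :: "'v list"
  assume "xs \<noteq> []"
  then obtain x ys where xs: "xs = x # ys" by (cases xs) auto
  have "emeasure (Pr v) (sstart UNIV xs) = emeasure seeds {s. v ## run step [v] s \<in> sstart UNIV xs}"
    unfolding Pr_def by (subst emeasure_distr) (auto simp: vimage_def sstart_sets)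
  also have "\<dots> = (if x = v then emeasure seeds {s. run step [v] s \<in> sstart UNIV ys} else 0)"
    by (simp add: xs)
  also have "\<dots> = ennreal (cyl_prob V1 V2 \<delta> \<sigma>1 \<sigma>2 v xs)"
    by (simp add: emeasure_run_sstart cyl_prob_def xs)
  finally show "emeasure (Pr v) (sstart UNIV xs) = ennreal (cyl_prob V1 V2 \<delta> \<sigma>1 \<sigma>2 v xs)" .
qed

text \<open>Cylinder probabilities determine a measure on streams. Statements about any
  \<open>P\<close> satisfying \<open>is_Pr\<close> can therefore be proved on
  \<open>seeds\<close>.\<close>

lemma is_Pr_unique:
  assumes "is_Pr V1 V2 \<delta> \<sigma>1 \<sigma>2 v P"
  shows "P = Pr v"
  using assms is_Pr_Pr[of v] unfolding is_Pr_def
  by (intro stream_space_eq_sstart[of UNIV]) auto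

section \<open>Almost every play is fair\<close>

text \<open>Finite-horizon form of \<open>unfair\<close>, which allows recursion on the horizon
  \<open>n\<close>. The number \<open>k\<close> counts missed opportunities to take the
  edge.\<close>

definition avoids :: "'v \<Rightarrow> 'v \<Rightarrow> nat \<Rightarrow> nat \<Rightarrow> 'v stream \<Rightarrow> bool" where
  "avoids u w n k \<omega> \<longleftrightarrow> (\<forall>i<n. \<omega> !! i = u \<longrightarrow> \<omega> !! Suc i \<noteq> w) \<and> k \<le> card {i. i < n \<and> \<omega> !! i = u}"

text \<open>The truncated \<open>k - 1\<close> is also right for \<open>k = 0\<close>, as
  \<open>k - 1 \<le> c\<close> and \<open>k \<le> 1 + c\<close> are equivalent.\<close>

lemma avoids_Suc:
  "avoids u w (Suc n) k (x ## \<omega>) \<longleftrightarrow>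
     (if x = u then shd \<omega> \<noteq> w \<and> avoids u w n (k - 1) \<omega> else avoids u w n k \<omega>)"
proof -
  have "{i. i < Suc n \<and> (x ## \<omega>) !! i = u} =
      (if x = u then {0} else {}) \<union> Suc ` {i. i < n \<and> \<omega> !! i = u}"
    by (auto simp: image_iff less_Suc_eq_0_disj)
  then have "card {i. i < Suc n \<and> (x ## \<omega>) !! i = u} =
      (if x = u then 1 else 0) + card {i. i < n \<and> \<omega> !! i = u}"
    by (auto simp: card_image card_insert_if)
  then show ?thesis unfolding avoids_def All_less_Suc2 by auto
qed

lemma measurable_avoids [measurable]:
  "Measurable.pred (stream_space (count_space UNIV)) (avoids u w n k)"
  unfolding avoids_def by measurable

text \<open>Whatever the history, a visit of \<open>u\<close> misses \<open>w\<close> with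
  probability \<open>1 - pmf (\<delta> u) w\<close>. The bound does not depend on the horizon
  \<open>n\<close>, so it survives the limit.\<close>

lemma emeasure_avoids_le:
  assumes "u \<notin> V1" "u \<notin> V2"
  shows "emeasure seeds {s. avoids u w n k (last h ## run step h s)} \<le> ennreal ((1 - pmf (\<delta> u) w) ^ k)"
proof (induction n arbitrary: k h)
  case 0
  show ?case using seeds.emeasure_le_1 by (cases k) (auto simp: avoids_def)
next
  case (Suc n)
  define q where "q = 1 - pmf (\<delta> u) w"
  have q: "0 \<le> q" by (simp add: q_def pmf_le_1)
  have "emeasure seeds {s. avoids u w (Suc n) k (last h ## run step h s)} =
     (\<integral>\<^sup>+t. emeasure seeds {s. avoids u w (Suc n) k (last h ## run step h (t ## s))} \<partial>seed)"
    by (rule emeasure_seeds) measurable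
  also have "\<dots> \<le> ennreal (q ^ k)"
  \<comment> \<open>Only a visit of \<open>u\<close> that still counts towards \<open>k\<close>
    contributes a factor \<open>q\<close>. A move from another vertex passes the bound on, and for
    \<open>k = 0\<close> the bound is 1.\<close>
  proof (cases "last h = u \<and> k > 0")
    case True
    have IH: "emeasure seeds {s. avoids u w n (k - 1) (step h t ## run step (h @ [step h t]) s)}
        \<le> ennreal (q ^ (k - 1))" for t
      using Suc[of "k - 1" "h @ [step h t]"] by (simp add: q_def)
    have "(\<integral>\<^sup>+t. emeasure seeds {s. avoids u w (Suc n) k (last h ## run step h (t ## s))} \<partial>seed)
        \<le> (\<integral>\<^sup>+t. ennreal (q ^ (k - 1)) * indicator {t. step h t \<noteq> w} t \<partial>seed)"
      by (rule nn_integral_mono)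
        (use True IH in \<open>auto simp: run_Stream avoids_Suc split: split_indicator\<close>)
    also have "\<dots> = ennreal (q ^ (k - 1)) * emeasure seed {t. step h t \<noteq> w}"
      by (rule nn_integral_cmult_indicator) (simp add: sets_seed)
    also have "emeasure seed {t. step h t \<noteq> w} = emeasure seed (space seed - {t. step h t = w})"
      by (rule arg_cong2[where f = emeasure]) auto
    also have "\<dots> = 1 - ennreal (step_prob V1 V2 \<delta> \<sigma>1 \<sigma>2 h w)"
      by (subst emeasure_compl)
        (simp_all add: sets_seed emeasure_seed_step seed.emeasure_space_1[simplified])
    also have "\<dots> = ennreal q"
      using True assms by (simp add: step_prob_def q_def ennreal_minus flip: ennreal_1)
    also have "ennreal (q ^ (k - 1)) * ennreal q = ennreal (q ^ k)"
      using True q by (cases k) (simp_all add: mult.commute flip: ennreal_mult)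
    finally show ?thesis .
  next
    case False
    have "emeasure seeds {s. avoids u w (Suc n) k (last h ## run step h (t ## s))} \<le> ennreal (q ^ k)" for t
    proof (cases "k = 0")
      case True
      then show ?thesis using seeds.emeasure_le_1 by simp
    next
      case k: False
      then show ?thesis
        using False Suc[of k "h @ [step h t]"] by (simp add: run_Stream avoids_Suc q_def)
    qed
    then have "(\<integral>\<^sup>+t. emeasure seeds {s. avoids u w (Suc n) k (last h ## run step h (t ## s))} \<partial>seed)
        \<le> (\<integral>\<^sup>+t. ennreal (q ^ k) \<partial>seed)"
      by (rule nn_integral_mono)
    then show ?thesis by (simp add: seed.emeasure_space_1[simplified])
  qed
  finally show ?case by (simp add: q_def)
qed

text \<open>The edge is missed from the very start. A play that visits \<open>u\<close> infinitely
  often but takes the edge only finitely often becomes unfair in this sense once a prefix is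
  dropped.\<close>

definition unfair :: "'v \<Rightarrow> 'v \<Rightarrow> 'v stream \<Rightarrow> bool" where
  "unfair u w \<omega> \<longleftrightarrow> (\<forall>i. \<omega> !! i = u \<longrightarrow> \<omega> !! Suc i \<noteq> w) \<and> (\<forall>m. \<exists>i>m. \<omega> !! i = u)"

lemma measurable_unfair [measurable]:
  "Measurable.pred (stream_space (count_space UNIV)) (unfair u w)"
  unfolding unfair_def by measurable

lemma unfair_imp_avoids:
  assumes "unfair u w \<omega>"
  shows "\<exists>n. avoids u w n k \<omega>"
proof -
  have "infinite {i. \<omega> !! i = u}"
    using assms unfolding unfair_def infinite_nat_iff_unbounded by auto
  then obtain F where F: "finite F" "F \<subseteq> {i. \<omega> !! i = u}" "card F = k"
    using infinite_arbitrarily_large by blast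
  obtain n where n: "F \<subseteq> {..<n}" using F(1) finite_nat_iff_bounded by blast
  have "card F \<le> card {i. i < n \<and> \<omega> !! i = u}" by (rule card_mono) (use F n in auto)
  then show ?thesis using assms F(3) unfolding unfair_def avoids_def by auto
qed

lemma avoids_unfair_mono:
  assumes "unfair u w \<omega>" "avoids u w m k \<omega>" "m \<le> n"
  shows "avoids u w n k \<omega>"
proof -
  have "card {i. i < m \<and> \<omega> !! i = u} \<le> card {i. i < n \<and> \<omega> !! i = u}"
    by (rule card_mono) (use assms(3) in auto)
  then show ?thesis using assms unfolding unfair_def avoids_def by auto
qed

text \<open>For every \<open>k\<close> the unfair plays are an increasing union over
  \<open>n\<close> of events of probability at most \<open>q ^ k\<close>. As \<open>q < 1\<close>,
  they form a null set.\<close>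

lemma AE_not_unfair:
  assumes u: "u \<notin> V1" "u \<notin> V2" and w: "w \<in> set_pmf (\<delta> u)"
  shows "AE s in seeds. \<not> unfair u w (last h ## run step h s)"
proof -
  let ?B = "{s. unfair u w (last h ## run step h s)}"
  let ?A = "\<lambda>k n. {s. unfair u w (last h ## run step h s) \<and> avoids u w n k (last h ## run step h s)}"
  define q where "q = 1 - pmf (\<delta> u) w"
  have q: "0 \<le> q" "q < 1" using pmf_positive[OF w] by (simp_all add: q_def pmf_le_1)
  have meas: "?B \<in> sets seeds" "?A k n \<in> sets seeds" for k n
  proof -
    have "{s\<in>space seeds. unfair u w (last h ## run step h s)} \<in> sets seeds" by measurable
    then show "?B \<in> sets seeds" by simp
    have "{s\<in>space seeds. unfair u w (last h ## run step h s) \<and>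
        avoids u w n k (last h ## run step h s)} \<in> sets seeds" by measurable
    then show "?A k n \<in> sets seeds" by simp
  qed
  have le: "emeasure seeds ?B \<le> ennreal (q ^ k)" for k
  proof -
    have "?B = (\<Union>n. ?A k n)" using unfair_imp_avoids[of u w _ k] by (simp add: set_eq_iff) blast
    moreover have "incseq (?A k)" using avoids_unfair_mono by (auto simp: incseq_def)
    moreover have "range (?A k) \<subseteq> sets seeds" using meas by blast
    ultimately have "emeasure seeds ?B = (SUP n. emeasure seeds (?A k n))"
      using SUP_emeasure_incseq[of "?A k" seeds] by (simp only:)
    also have "\<dots> \<le> ennreal (q ^ k)"
    proof (rule SUP_least)
      fix n
      have "{s\<in>space seeds. avoids u w n k (last h ## run step h s)} \<in> sets seeds" by measurable
      then have "emeasure seeds (?A k n) \<le> emeasure seeds {s. avoids u w n k (last h ## run step h s)}"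
        by (intro emeasure_mono) auto
      also have "\<dots> \<le> ennreal (q ^ k)" unfolding q_def by (rule emeasure_avoids_le[OF u])
      finally show "emeasure seeds (?A k n) \<le> ennreal (q ^ k)" .
    qed
    finally show ?thesis .
  qed
  have "(\<lambda>k. ennreal (q ^ k)) \<longlonglongrightarrow> ennreal 0"
    using q by (intro tendsto_ennrealI LIMSEQ_power_zero) auto
  then have "emeasure seeds ?B \<le> 0"
    by (intro LIMSEQ_le_const) (use le in auto)
  then have "?B \<in> null_sets seeds" using meas by auto
  then show ?thesis by (rule AE_I') auto
qed

text \<open>After one step the play is again a run, from a longer history; hence the induction for
  all \<open>h\<close>.\<close>

lemma AE_not_unfair_sdrop:
  assumes u: "u \<notin> V1" "u \<notin> V2" and w: "w \<in> set_pmf (\<delta> u)"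
  shows "AE s in seeds. \<not> unfair u w (sdrop n (last h ## run step h s))"
proof (induction n arbitrary: h)
  case 0
  show ?case using AE_not_unfair[OF assms] by simp
next
  case (Suc n)
  have "AE s in seeds. \<not> unfair u w (sdrop n (step h t ## run step (h @ [step h t]) s))" for t
    using Suc[of "h @ [step h t]"] by simp
  moreover have "Measurable.pred seeds (\<lambda>s. \<not> unfair u w (sdrop (Suc n) (last h ## run step h s)))"
    by measurable
  ultimately show ?case
    unfolding seeds_def by (subst seed.AE_stream_space) (simp_all add: run_Stream)
qed

text \<open>Almost every stream of seeds takes all its values in the supports, and for such seeds
  the properties hold without exception. \<open>V2 - V1\<close> reflects that \<open>step\<close>
  consults \<open>V1\<close> first, disjointness not being assumed in this locale.\<close>

lemma AE_Pr_play:
  assumes P: "is_Pr V1 V2 \<delta> \<sigma>1 \<sigma>2 v P"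
  shows "AE \<omega> in P. \<omega> !! 0 = v \<and>
    (\<forall>n. \<omega> !! n \<in> V1 \<longrightarrow> \<omega> !! Suc n = \<sigma>1 (stake (Suc n) \<omega>)) \<and>
    (\<forall>n. \<omega> !! n \<in> V2 - V1 \<longrightarrow> \<omega> !! Suc n = \<sigma>2 (stake (Suc n) \<omega>)) \<and>
    (\<forall>n. \<omega> !! n \<notin> V1 \<union> V2 \<longrightarrow> \<omega> !! Suc n \<in> set_pmf (\<delta> (\<omega> !! n)))"
proof -
  have "AE \<xi> in seed. \<forall>x. \<xi> x \<in> set_pmf (\<delta> x)"
    unfolding seed_def by (auto simp: AE_measure_pmf_iff set_Pi_pmf PiE_dflt_def)
  then have "AE s in seeds. stream_all (\<lambda>\<xi>. \<forall>x. \<xi> x \<in> set_pmf (\<delta> x)) s"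
    unfolding seeds_def by (rule seed.AE_stream_all[rotated]) measurable
  then have "AE s in seeds. let \<omega> = v ## run step [v] s in \<omega> !! 0 = v \<and>
    (\<forall>n. \<omega> !! n \<in> V1 \<longrightarrow> \<omega> !! Suc n = \<sigma>1 (stake (Suc n) \<omega>)) \<and>
    (\<forall>n. \<omega> !! n \<in> V2 - V1 \<longrightarrow> \<omega> !! Suc n = \<sigma>2 (stake (Suc n) \<omega>)) \<and>
    (\<forall>n. \<omega> !! n \<notin> V1 \<union> V2 \<longrightarrow> \<omega> !! Suc n \<in> set_pmf (\<delta> (\<omega> !! n)))"
  proof (rule eventually_mono)
    fix s
    assume s: "stream_all (\<lambda>\<xi>. \<forall>x. \<xi> x \<in> set_pmf (\<delta> x)) s"
    let ?\<omega> = "v ## run step [v] s"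
    have step: "?\<omega> !! Suc n = step (stake (Suc n) ?\<omega>) (s !! n)" for n
      by (simp add: run_snth[of step "[v]" s n])
    have last: "last (stake (Suc n) ?\<omega>) = ?\<omega> !! n" for n
      by (subst stake_Suc) simp
    have "(s !! n) x \<in> set_pmf (\<delta> x)" for n x using s by (simp add: stream_all_def)
    then show "let \<omega> = ?\<omega> in \<omega> !! 0 = v \<and>
      (\<forall>n. \<omega> !! n \<in> V1 \<longrightarrow> \<omega> !! Suc n = \<sigma>1 (stake (Suc n) \<omega>)) \<and>
      (\<forall>n. \<omega> !! n \<in> V2 - V1 \<longrightarrow> \<omega> !! Suc n = \<sigma>2 (stake (Suc n) \<omega>)) \<and>
      (\<forall>n. \<omega> !! n \<notin> V1 \<union> V2 \<longrightarrow> \<omega> !! Suc n \<in> set_pmf (\<delta> (\<omega> !! n)))"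
      unfolding Let_def step step_def last by simp
  qed
  then show ?thesis
    unfolding is_Pr_unique[OF P] Pr_def Let_def
    by (subst AE_distr_iff) measurable
qed

lemma AE_Pr_fair:
  assumes P: "is_Pr V1 V2 \<delta> \<sigma>1 \<sigma>2 v P"
  shows "AE \<omega> in P. \<forall>u w. u \<notin> V1 \<union> V2 \<longrightarrow> w \<in> set_pmf (\<delta> u) \<longrightarrow>
    (\<exists>\<^sub>\<infinity>n. \<omega> !! n = u) \<longrightarrow> (\<exists>\<^sub>\<infinity>n. \<omega> !! n = u \<and> \<omega> !! Suc n = w)"
proof -
  have "AE s in seeds. \<forall>n u w. u \<notin> V1 \<union> V2 \<longrightarrow> w \<in> set_pmf (\<delta> u) \<longrightarrow>
      \<not> unfair u w (sdrop n (v ## run step [v] s))"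
    unfolding AE_all_countable using AE_not_unfair_sdrop[of _ _ _ "[v]"] by auto
  then have "AE \<omega> in P. \<forall>n u w. u \<notin> V1 \<union> V2 \<longrightarrow> w \<in> set_pmf (\<delta> u) \<longrightarrow> \<not> unfair u w (sdrop n \<omega>)"
    unfolding is_Pr_unique[OF P] Pr_def by (subst AE_distr_iff) measurable
  then show ?thesis
  proof (rule eventually_mono, intro allI impI)
    fix \<omega> u w
    assume nu: "\<forall>n u w. u \<notin> V1 \<union> V2 \<longrightarrow> w \<in> set_pmf (\<delta> u) \<longrightarrow> \<not> unfair u w (sdrop n \<omega>)"
      and uw: "u \<notin> V1 \<union> V2" "w \<in> set_pmf (\<delta> u)" and inf: "\<exists>\<^sub>\<infinity>n. \<omega> !! n = u"
    show "\<exists>\<^sub>\<infinity>n. \<omega> !! n = u \<and> \<omega> !! Suc n = w"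
    proof (rule ccontr)
      assume "\<not> ?thesis"
      \<comment> \<open>From time \<open>N\<close> on the edge is never taken, so dropping
        \<open>N\<close> vertices exhibits an \<open>unfair\<close> play.\<close>
      then obtain N where N: "\<And>n. n \<ge> N \<Longrightarrow> \<omega> !! n = u \<Longrightarrow> \<omega> !! Suc n \<noteq> w"
        by (auto simp: INFM_nat_le)
      have "\<exists>i>m. sdrop N \<omega> !! i = u" for m
      proof -
        obtain j where "j > N + m" "\<omega> !! j = u" using inf unfolding INFM_nat by blast
        then show ?thesis by (intro exI[of _ "j - N"]) (simp add: sdrop_snth)
      qed
      then have "unfair u w (sdrop N \<omega>)" using N by (simp add: unfair_def sdrop_snth)
      then show False using nu uw by blast
    qed
  qed
qed

end

lemma measurable_Parity: "Parity \<Omega> \<in> sets (stream_space (count_space (UNIV :: 'v::finite set)))"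
proof -
  have "Parity \<Omega> = {\<omega>\<in>space (stream_space (count_space (UNIV :: 'v set))).
      \<exists>p. even p \<and> (\<forall>m. \<exists>n>m. \<Omega> (\<omega> !! n) = p) \<and> (\<exists>m. \<forall>n>m. \<Omega> (\<omega> !! n) \<le> p)}"
    by (simp add: set_eq_iff Parity_iff_limit_priority limit_priority_def space_stream_space
        INFM_nat MOST_nat)
  also have "\<dots> \<in> sets (stream_space (count_space UNIV))" by measurable
  finally show ?thesis .
qed

section \<open>Sure and almost-sure winning\<close>

lemma sstart_iff_stake: "\<omega> \<in> sstart UNIV xs \<longleftrightarrow> stake (length xs) \<omega> = xs"
  by (induction xs arbitrary: \<omega>) auto

text \<open>Dependent choice yields histories \<open>H n\<close>, each a proper prefix of the next;
  they converge to a stream.\<close>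

lemma ex_stream_of_extensions:
  assumes "Q h" and ext: "\<And>h. Q h \<Longrightarrow> \<exists>g. g \<noteq> [] \<and> Q (h @ g) \<and> R (last g)"
  shows "\<exists>\<omega>. \<forall>n. \<exists>m>n. Q (stake (Suc m) \<omega>) \<and> R (\<omega> !! m)"
proof -
  have "\<exists>H. \<forall>n. Q (H n) \<and> (\<exists>g. g \<noteq> [] \<and> H (Suc n) = H n @ g \<and> R (last g))"
  proof (rule dependent_nat_choice)
    show "\<exists>h. Q h" using assms(1) by blast
    show "\<exists>h'. Q h' \<and> (\<exists>g. g \<noteq> [] \<and> h' = h @ g \<and> R (last g))" if "Q h" for h n
      using ext[OF that] by blast
  qed
  then obtain H where Q: "\<And>n. Q (H n)"
    and H: "\<And>n. \<exists>g. g \<noteq> [] \<and> H (Suc n) = H n @ g \<and> R (last g)" by blast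
  have len: "n \<le> length (H n)" for n
  proof (induction n)
    case (Suc n)
    obtain g where "g \<noteq> []" "H (Suc n) = H n @ g" using H by blast
    then show ?case using Suc by (cases g) auto
  qed simp
  have mono: "H n ! i = H m ! i \<and> i < length (H n)" if "m \<le> n" "i < length (H m)" for m n i
    using that
  proof (induction n rule: dec_induct)
    case (step n)
    obtain g where "H (Suc n) = H n @ g" using H by blast
    then show ?case using step by (simp add: nth_append)
  qed simp
  \<comment> \<open>Position \<open>i\<close> is read off \<open>H (Suc i)\<close>, which is long
    enough by \<open>len\<close>.\<close>
  define \<omega> where "\<omega> = to_stream (\<lambda>i. H (Suc i) ! i)"
  have snth: "\<omega> !! i = H n ! i" if "i < length (H n)" for i n
  proof -
    have "i < length (H (Suc i))" using len[of "Suc i"] by simp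
    then have "H (Suc i) ! i = H n ! i"
      using mono[of "Suc i" n i] mono[of n "Suc i" i] that by (cases "n \<le> Suc i") auto
    then show ?thesis by (simp add: \<omega>_def to_stream_def)
  qed
  have stake: "stake (length (H n)) \<omega> = H n" for n
    by (rule nth_equalityI) (simp_all add: snth)
  have "\<exists>m>n. Q (stake (Suc m) \<omega>) \<and> R (\<omega> !! m)" for n
  proof -
    let ?k = "Suc (Suc n)"
    obtain g where g: "g \<noteq> []" "H (Suc ?k) = H ?k @ g" "R (last g)" using H by blast
    let ?m = "length (H (Suc ?k)) - 1"
    have m: "Suc ?m = length (H (Suc ?k))" using g by (cases g) auto
    have "\<omega> !! ?m = H (Suc ?k) ! ?m" by (rule snth) (use m in simp)
    also have "\<dots> = last (H (Suc ?k))" using m by (intro last_conv_nth[symmetric]) auto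
    also have "\<dots> = last g" using g(1,2) by simp
    finally have "\<omega> !! ?m = last g" .
    moreover have "stake (Suc ?m) \<omega> = H (Suc ?k)" using stake[of "Suc ?k"] m by simp
    moreover have "?m > n" using len[of "Suc ?k"] m by simp
    ultimately show ?thesis using Q[of "Suc ?k"] g(3) by (intro exI[of _ ?m]) simp
  qed
  then show ?thesis by blast
qed

locale sas_game =
  fixes V1 V2 VP :: "'v::finite set" and E :: "('v \<times> 'v) set" and \<delta> :: "'v \<Rightarrow> 'v pmf"
    and \<Omega>1 \<Omega>2 :: "'v \<Rightarrow> nat"
  assumes game: "stoch_game V1 V2 VP E \<delta>" and coBuchi: "\<Omega>1 u \<le> 1"
begin

lemma V_disjoint: "V1 \<inter> V2 = {}"
  using game unfolding stoch_game_def by blast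

lemma ex_succ: "\<exists>w. (u, w) \<in> E"
  using game unfolding stoch_game_def by blast

lemma set_pmf_iff: "u \<notin> V1 \<Longrightarrow> u \<notin> V2 \<Longrightarrow> w \<in> set_pmf (\<delta> u) \<longleftrightarrow> (u, w) \<in> E"
  using game unfolding stoch_game_def by blast

sublocale fair_game "\<lambda>b. if b then V1 else V2" E \<Omega>2
  using V_disjoint by unfold_locales auto

definition consistent :: "('v list \<Rightarrow> 'v) \<Rightarrow> 'v \<Rightarrow> 'v list \<Rightarrow> bool" where
  "consistent \<sigma> v h \<longleftrightarrow> history E h \<and> hd h = v \<and>
     (\<forall>i. Suc i < length h \<longrightarrow> h ! i \<in> V1 \<longrightarrow> h ! Suc i = \<sigma> (take (Suc i) h))"

lemma consistent_snoc:
  assumes "consistent \<sigma> v h" "(last h, w) \<in> E" "last h \<in> V1 \<Longrightarrow> w = \<sigma> h"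
  shows "consistent \<sigma> v (h @ [w])"
proof -
  have h: "h \<noteq> []" using assms(1) by (simp add: consistent_def history_def)
  have "((h @ [w]) ! i, (h @ [w]) ! Suc i) \<in> E \<and>
      ((h @ [w]) ! i \<in> V1 \<longrightarrow> (h @ [w]) ! Suc i = \<sigma> (take (Suc i) (h @ [w])))"
    if "Suc i < length (h @ [w])" for i
  proof (cases "Suc i < length h")
    case True
    then show ?thesis using assms(1) by (simp add: consistent_def history_def nth_append)
  next
    case False
    then have i: "i = length h - 1" using that by simp
    then have "Suc i = length h" using h by (cases h) auto
    moreover have "h ! i = last h" using i h by (simp add: last_conv_nth)
    ultimately show ?thesis using assms(2,3) by (simp add: nth_append)
  qed
  moreover have "hd (h @ [w]) = v" using assms(1) h by (simp add: consistent_def)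
  ultimately show ?thesis by (simp add: consistent_def history_def)
qed

lemma consistent_last_step:
  assumes "consistent \<sigma> v (h @ [w])" "h \<noteq> []"
  shows "(last h, w) \<in> E"
proof -
  have "Suc (length h - 1) = length h" using assms(2) by (cases h) auto
  then have "((h @ [w]) ! (length h - 1), (h @ [w]) ! length h) \<in> E"
    using assms unfolding consistent_def history_def by (metis length_append_singleton lessI)
  then show ?thesis using assms(2) by (simp add: nth_append last_conv_nth)
qed

text \<open>Consistency passes to shorter prefixes, so arbitrarily long consistent prefixes suffice.
  This is the form in which \<open>ex_stream_of_extensions\<close> delivers a play.\<close>

lemma Out_iff_consistent: "\<omega> \<in> Out E V1 v \<sigma> \<longleftrightarrow> (\<forall>n. \<exists>m>n. consistent \<sigma> v (stake (Suc m) \<omega>))"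
proof
  assume \<omega>: "\<omega> \<in> Out E V1 v \<sigma>"
  have "consistent \<sigma> v (stake (Suc m) \<omega>)" for m
    using \<omega> unfolding Out_def play_def consistent_def history_def
    by (simp add: take_stake min_def del: stake.simps) simp
  then show "\<forall>n. \<exists>m>n. consistent \<sigma> v (stake (Suc m) \<omega>)" by blast
next
  assume c: "\<forall>n. \<exists>m>n. consistent \<sigma> v (stake (Suc m) \<omega>)"
  have "(\<omega> !! n, \<omega> !! Suc n) \<in> E \<and> shd \<omega> = v \<and>
      (\<omega> !! n \<in> V1 \<longrightarrow> \<omega> !! Suc n = \<sigma> (stake (Suc n) \<omega>))" for n
  proof -
    obtain m where m: "m > n" "consistent \<sigma> v (stake (Suc m) \<omega>)" using c by blast
    have "Suc n < length (stake (Suc m) \<omega>)" using m(1) by simp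
    moreover have "stake (Suc m) \<omega> ! n = \<omega> !! n" "stake (Suc m) \<omega> ! Suc n = \<omega> !! Suc n"
      using m(1) by (simp_all del: stake.simps snth.simps)
    moreover have "take (Suc n) (stake (Suc m) \<omega>) = stake (Suc n) \<omega>"
      using m(1) by (simp only: take_stake) (simp add: min_def)
    moreover have "hd (stake (Suc m) \<omega>) = shd \<omega>" by simp
    ultimately show ?thesis using m(2) unfolding consistent_def history_def by metis
  qed
  then show "\<omega> \<in> Out E V1 v \<sigma>" unfolding Out_def play_def by blast
qed

text \<open>The link between probability and combinatorics: from here on almost-sure winning is
  treated through fair plays.\<close>

lemma AE_Out_fair:
  assumes "strategy E V1 \<sigma>1" "strategy E V2 \<sigma>2" "is_Pr V1 V2 \<delta> \<sigma>1 \<sigma>2 v P"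
  shows "AE \<omega> in P. \<omega> \<in> Out E V1 v \<sigma>1 \<and> \<omega> \<in> Out E V2 v \<sigma>2 \<and> fair (snth \<omega>)"
proof -
  interpret play_measure V1 V2 \<delta> \<sigma>1 \<sigma>2 .
  show ?thesis
    using AE_Pr_play[OF assms(3)] AE_Pr_fair[OF assms(3)]
  proof eventually_elim
    case (elim \<omega>)
    have edge: "(\<omega> !! n, \<omega> !! Suc n) \<in> E" for n
    \<comment> \<open>A strategy is bound to follow edges on genuine histories only, so all earlier
      steps must be known to be edges.\<close>
    proof (induction n rule: less_induct)
      case (less n)
      have "history E (stake (Suc n) \<omega>)"
        using less unfolding history_def by (simp del: stake.simps snth.simps)
      moreover have "last (stake (Suc n) \<omega>) = \<omega> !! n" by (subst stake_Suc) simp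
      ultimately show ?case
        using elim(1) assms(1,2) V_disjoint set_pmf_iff unfolding strategy_def
        by (metis DiffI Un_iff disjoint_iff)
    qed
    have "\<omega> !! n \<in> V2 \<Longrightarrow> \<omega> !! n \<in> V2 - V1" for n using V_disjoint by blast
    then have "\<omega> \<in> Out E V1 v \<sigma>1" "\<omega> \<in> Out E V2 v \<sigma>2"
      using edge elim(1) unfolding Out_def play_def by (simp_all del: stake.simps)
    moreover have "fair (snth \<omega>)"
      using elim(2) set_pmf_iff unfolding fair_def random_def by simp
    ultimately show ?case by blast
  qed
qed

lemma Parity_iff_win: "\<omega> \<in> Parity \<Omega>2 \<longleftrightarrow> win True (snth \<omega>)"
  by (simp add: Parity_iff_limit_priority win_def)

lemma Parity_coBuchi_iff: "\<omega> \<in> Parity \<Omega>1 \<longleftrightarrow> (\<forall>\<^sub>\<infinity>n. \<Omega>1 (\<omega> !! n) = 0)"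
proof
  assume "\<omega> \<in> Parity \<Omega>1"
  then obtain p where p: "even p" "limit_priority \<Omega>1 (snth \<omega>) p"
    by (auto simp: Parity_iff_limit_priority)
  then obtain n where "\<Omega>1 (\<omega> !! n) = p" unfolding limit_priority_def using INFM_EX by blast
  then have "p = 0" using coBuchi[of "\<omega> !! n"] p(1) by (cases p) auto
  then show "\<forall>\<^sub>\<infinity>n. \<Omega>1 (\<omega> !! n) = 0" using p(2) unfolding limit_priority_def by simp
next
  assume "\<forall>\<^sub>\<infinity>n. \<Omega>1 (\<omega> !! n) = 0"
  then have "limit_priority \<Omega>1 (snth \<omega>) 0"
    unfolding limit_priority_def by (auto intro: MOST_INFM)
  then show "\<omega> \<in> Parity \<Omega>1" by (auto simp: Parity_iff_limit_priority intro!: exI[of _ 0])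
qed

section \<open>Regions for the combined objective\<close>

text \<open>The coBuchi condition is required of every conforming play, the parity condition
  \<open>\<Omega>2\<close> only of fair ones; this matches sure and almost-sure winning.
  \<open>X\<close> is a trap in the whole game.\<close>

definition sas_region :: "'v set \<Rightarrow> ('v \<Rightarrow> 'v) \<Rightarrow> bool" where
  "sas_region X \<tau> \<longleftrightarrow> (\<forall>x\<in>X \<inter> V1. \<tau> x \<in> X \<and> (x, \<tau> x) \<in> E) \<and>
     (\<forall>x\<in>X - V1. \<forall>w. (x, w) \<in> E \<longrightarrow> w \<in> X) \<and>
     (\<forall>f. conforms True \<tau> X f \<longrightarrow> (\<forall>\<^sub>\<infinity>n. \<Omega>1 (f n) = 0) \<and> (fair f \<longrightarrow> win True f))"

lemma sas_region_memoryless: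
  assumes X: "sas_region X \<tau>" and v: "v \<in> X"
  shows "\<exists>\<sigma>. strategy E V1 \<sigma> \<and> memoryless E V1 \<sigma> \<and>
    sure_winning E V1 v \<sigma> (Parity \<Omega>1) \<and> as_winning V1 V2 E \<delta> v \<sigma> (Parity \<Omega>2)"
proof -
  \<comment> \<open>Outside of \<open>X\<close> an arbitrary successor makes \<open>\<sigma>\<close>
    a strategy on all histories.\<close>
  define \<sigma> where "\<sigma> h = (if last h \<in> X then \<tau> (last h) else SOME w. (last h, w) \<in> E)" for h
  have strat: "strategy E V1 \<sigma>"
    using X someI_ex[OF ex_succ] unfolding strategy_def \<sigma>_def sas_region_def by simp
  have conf: "conforms True \<tau> X (snth \<omega>)" if \<omega>: "\<omega> \<in> Out E V1 v \<sigma>" for \<omega>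
  proof -
    have last: "last (stake (Suc n) \<omega>) = \<omega> !! n" for n by (subst stake_Suc) simp
    have edge: "(\<omega> !! n, \<omega> !! Suc n) \<in> E"
      and \<sigma>n: "\<omega> !! n \<in> V1 \<Longrightarrow> \<omega> !! Suc n = \<sigma> (stake (Suc n) \<omega>)" for n
      using \<omega> unfolding Out_def play_def by blast+
    have inX: "\<omega> !! n \<in> X" for n
    proof (induction n)
      case 0
      then show ?case using \<omega> v by (simp add: Out_def)
    next
      case (Suc n)
      show ?case
      proof (cases "\<omega> !! n \<in> V1")
        case True
        then have "\<omega> !! Suc n = \<tau> (\<omega> !! n)" using \<sigma>n[OF True] Suc unfolding \<sigma>_def last by simp
        then show ?thesis using X True Suc unfolding sas_region_def by (simp del: snth.simps)
      next
        case False
        then show ?thesis using X Suc edge[of n] unfolding sas_region_def by blast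
      qed
    qed
    show ?thesis
      unfolding conforms_def using inX edge \<sigma>n unfolding \<sigma>_def last by (simp del: snth.simps)
  qed
  have "memoryless E V1 \<sigma>" by (simp add: memoryless_def \<sigma>_def)
  moreover have "sure_winning E V1 v \<sigma> (Parity \<Omega>1)"
    using conf X unfolding sure_winning_def sas_region_def
    by (auto simp: Parity_coBuchi_iff)
  moreover have "as_winning V1 V2 E \<delta> v \<sigma> (Parity \<Omega>2)"
    unfolding as_winning_def
  proof (intro allI impI)
    fix \<sigma>2 P
    assume \<sigma>2: "strategy E V2 \<sigma>2" and P: "is_Pr V1 V2 \<delta> \<sigma> \<sigma>2 v P"
    interpret P: prob_space P using P by (simp add: is_Pr_def)
    have "Parity \<Omega>2 \<in> sets P" using P measurable_Parity by (simp add: is_Pr_def)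
    moreover have "AE \<omega> in P. \<omega> \<in> Parity \<Omega>2"
      using AE_Out_fair[OF strat \<sigma>2 P]
    proof eventually_elim
      case (elim \<omega>)
      then show ?case using X conf[of \<omega>] unfolding sas_region_def Parity_iff_win by blast
    qed
    ultimately show "emeasure P (Parity \<Omega>2) = 1" by (intro P.emeasure_eq_1_AE)
  qed
  ultimately show ?thesis using strat by blast
qed

text \<open>The witness \<^term>\<open>\<sigma>2\<close> first follows \<^term>\<open>h\<close>, which has positive probability,
  and then plays \<^term>\<open>\<tau>\<close>.\<close>

lemma no_opponent_region:
  assumes \<sigma>1: "strategy E V1 \<sigma>1" and as: "as_winning V1 V2 E \<delta> v \<sigma>1 (Parity \<Omega>2)"
    and h: "consistent \<sigma>1 v h" "last h \<in> U"
    and \<tau>: "\<forall>x\<in>U \<inter> V2. \<tau> x \<in> U \<and> (x, \<tau> x) \<in> E"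
    and win: "\<And>f. conforms False \<tau> U f \<Longrightarrow> fair f \<Longrightarrow> win False f"
    and closed: "\<And>g w. consistent \<sigma>1 v (h @ g @ [w]) \<Longrightarrow> set g \<subseteq> U \<Longrightarrow> last (h @ g) \<in> U - V2 \<Longrightarrow> w \<in> U"
  shows False
proof -
  have hne: "h \<noteq> []" and hist: "\<And>i. Suc i < length h \<Longrightarrow> (h ! i, h ! Suc i) \<in> E"
    using h(1) by (simp_all add: consistent_def history_def)
  define \<sigma>2 where "\<sigma>2 g = (if length g < length h \<and> g = take (length g) h then h ! length g
    else if last g \<in> U then \<tau> (last g) else SOME w. (last g, w) \<in> E)" for g
  have strat: "strategy E V2 \<sigma>2"
    unfolding strategy_def
  proof (intro allI impI)
    fix g
    assume g: "history E g \<and> last g \<in> V2"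
    show "(last g, \<sigma>2 g) \<in> E"
    proof (cases "length g < length h \<and> g = take (length g) h")
      case True
      have gne: "g \<noteq> []" using g by (simp add: history_def)
      then have len: "Suc (length g - 1) = length g" by (cases g) auto
      have "last g = take (length g) h ! (length g - 1)" using True gne last_conv_nth by metis
      also have "\<dots> = h ! (length g - 1)" using len by simp
      finally show ?thesis using hist[of "length g - 1"] True len by (simp add: \<sigma>2_def)
    next
      case False
      then show ?thesis using g \<tau> someI_ex[OF ex_succ, of "last g"] unfolding \<sigma>2_def by auto
    qed
  qed
  interpret play_measure V1 V2 \<delta> \<sigma>1 \<sigma>2 .
  note Pr = is_Pr_Pr[of v]
  interpret P: prob_space "Pr v" using Pr by (simp add: is_Pr_def)
  \<comment> \<open>Each step of \<open>h\<close> is prescribed by \<open>\<sigma>1\<close>, copied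
    by \<open>\<sigma>2\<close>, or an edge of a random vertex.\<close>
  have "step_prob V1 V2 \<delta> \<sigma>1 \<sigma>2 (take (Suc k) h) (h ! Suc k) > 0" if k: "k < length h - 1" for k
  proof -
    have k': "Suc k < length h" using k by simp
    have last: "last (take (Suc k) h) = h ! k" using k' by (simp add: take_Suc_conv_app_nth)
    have "h ! k \<in> V1 \<Longrightarrow> h ! Suc k = \<sigma>1 (take (Suc k) h)"
      using h(1) k' by (simp add: consistent_def)
    moreover have "\<sigma>2 (take (Suc k) h) = h ! Suc k" using k' by (simp add: \<sigma>2_def min_def)
    moreover have "pmf (\<delta> (h ! k)) (h ! Suc k) > 0" if "h ! k \<notin> V1" "h ! k \<notin> V2"
      using set_pmf_iff[OF that] hist[OF k'] by (simp add: pmf_positive_iff)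
    ultimately show ?thesis unfolding step_prob_def last by simp
  qed
  then have "cyl_prob V1 V2 \<delta> \<sigma>1 \<sigma>2 v h > 0"
    using h(1) unfolding cyl_prob_def consistent_def by (auto intro!: prod_pos)
  then have pos: "emeasure (Pr v) (sstart UNIV h) \<noteq> 0"
    using Pr hne by (simp add: is_Pr_def)
  have "emeasure (Pr v) (Parity \<Omega>2) = 1" using as strat Pr unfolding as_winning_def by blast
  moreover have "Parity \<Omega>2 \<in> sets (Pr v)" using Pr measurable_Parity by (simp add: is_Pr_def)
  ultimately have "AE \<omega> in Pr v. \<omega> \<in> Parity \<Omega>2"
    by (simp add: P.emeasure_eq_measure P.AE_in_set_eq_1)
  \<comment> \<open>Every fair play that follows both strategies and starts with \<open>h\<close> is
    lost for Player 1, so the cylinder of \<open>h\<close> would be null, contrary to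
    \<open>pos\<close>.\<close>
  then have "AE \<omega> in Pr v. \<omega> \<notin> sstart UNIV h"
    using AE_Out_fair[OF \<sigma>1 strat Pr]
  proof eventually_elim
    case (elim \<omega>)
    show ?case
    proof
      assume "\<omega> \<in> sstart UNIV h"
      then have \<omega>h: "stake (length h) \<omega> = h" by (simp add: sstart_iff_stake)
      \<comment> \<open>The tail \<open>f\<close> starts at the last vertex of \<open>h\<close>,
        which lies in \<open>U\<close>.\<close>
      define k where "k = length h - 1"
      have k: "Suc k = length h" using hne by (cases h) (auto simp: k_def)
      define f where "f n = \<omega> !! (n + k)" for n
      have last: "last (stake (Suc n) \<omega>) = \<omega> !! n" for n by (subst stake_Suc) simp
      have cons: "consistent \<sigma>1 v (stake (Suc n) \<omega>)" for n
        using elim(2) unfolding Out_def play_def consistent_def history_def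
        by (simp add: take_stake min_def del: stake.simps) simp
      have edge: "(f n, f (Suc n)) \<in> E" for n
        using elim(2) unfolding Out_def play_def f_def by simp
      have f2: "f (Suc n) = \<tau> (f n)" if "f n \<in> U" "f n \<in> V2" for n
      proof -
        have "f (Suc n) = \<sigma>2 (stake (Suc (n + k)) \<omega>)"
          using elim(2) that(2) unfolding Out_def f_def by simp
        moreover have "\<not> length (stake (Suc (n + k)) \<omega>) < length h" using k by simp
        ultimately show ?thesis using that(1) last[of "n + k"] unfolding \<sigma>2_def f_def by simp
      qed
      \<comment> \<open>At Player 2 vertices \<open>\<tau>\<close> stays in \<open>U\<close>.
        Elsewhere \<open>closed\<close> applies; it asks for all vertices since \<open>h\<close> to
        lie in \<open>U\<close>, hence the strong induction.\<close>
      have U: "f n \<in> U" for n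
      proof (induction n rule: less_induct)
        case (less n)
        show ?case
        proof (cases n)
          case 0
          then show ?thesis using h(2) \<omega>h last[of k] k by (simp add: f_def)
        next
          case (Suc m)
          then have m: "f m \<in> U" using less by simp
          show ?thesis
          proof (cases "f m \<in> V2")
            case True
            then show ?thesis using f2[OF m True] \<tau> m Suc by simp
          next
            case False
            define g where "g = stake m (sdrop (length h) \<omega>)"
            have hg: "h @ g = stake (Suc (m + k)) \<omega>"
              proof -
              have "Suc (m + k) = length h + m" using k by simp
              then show ?thesis using stake_add[of "length h" \<omega> m] \<omega>h by (simp only: g_def)
            qed
            have "h @ g @ [f n] = stake (Suc (Suc (m + k))) \<omega>"
              unfolding append_assoc[symmetric] hg f_def Suc
              by (subst (2) stake_Suc) simp
            then have 1: "consistent \<sigma>1 v (h @ g @ [f n])" using cons by metis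
            have "set g \<subseteq> U"
            proof
              fix x
              assume "x \<in> set g"
              then obtain i where i: "i < m" "x = sdrop (length h) \<omega> !! i"
                unfolding in_set_conv_nth g_def by (metis length_stake stake_nth)
              then have "x = f (Suc i)" unfolding f_def sdrop_snth
                using arg_cong[of "length h + i" "Suc i + k" "snth \<omega>"] k by simp
              then show "x \<in> U" using less[of "Suc i"] i(1) Suc by simp
            qed
            moreover have "last (h @ g) \<in> U - V2" using m False last[of "m + k"] hg by (simp add: f_def)
            ultimately show ?thesis using closed[OF 1] by blast
          qed
        qed
      qed
      have "conforms False \<tau> U f" using U edge f2 unfolding conforms_def by simp
      moreover have "fair f" using fair_shift[of "snth \<omega>" k] elim unfolding f_def by simp
      ultimately have "win False f" by (rule win)
      then have "win False (snth \<omega>)" using win_shift[of False "snth \<omega>" k] unfolding f_def by simp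
      then show False using elim(1) not_win_both[of True] unfolding Parity_iff_win by simp
    qed
  qed
  moreover have "sstart UNIV h \<in> sets (Pr v)" using Pr sstart_sets by (simp add: is_Pr_def)
  ultimately have "emeasure (Pr v) (sstart UNIV h) = 0"
    by (subst (asm) AE_iff_measurable[of "sstart UNIV h"])
      (use Pr sets_eq_imp_space_eq[of "Pr v"] in \<open>auto simp: is_Pr_def space_stream_space\<close>)
  then show False using pos by simp
qed

text \<open>A play that reaches \<open>X\<close> stays there, and its tail meets both conditions. A
  play that never does is confined to \<open>U\<close>. So \<open>U\<close> has to be closed only up
  to exits into \<open>X\<close>.\<close>

lemma sas_region_extend:
  assumes X: "sas_region X \<tau>X" and disj: "X \<inter> U = {}"
    and \<tau>: "\<forall>x\<in>U \<inter> V1. \<tau> x \<in> U \<union> X \<and> (x, \<tau> x) \<in> E"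
    and closed: "\<forall>x\<in>U - V1. \<forall>w. (x, w) \<in> E \<longrightarrow> w \<in> U \<union> X"
    and U: "\<And>f. conforms True \<tau> U f \<Longrightarrow> (\<forall>\<^sub>\<infinity>n. \<Omega>1 (f n) = 0) \<and> (fair f \<longrightarrow> win True f)"
  shows "sas_region (X \<union> U) (\<lambda>x. if x \<in> X then \<tau>X x else \<tau> x)"
    (is "sas_region _ ?\<tau>")
proof -
  have "(\<forall>\<^sub>\<infinity>n. \<Omega>1 (f n) = 0) \<and> (fair f \<longrightarrow> win True f)" if f: "conforms True ?\<tau> (X \<union> U) f" for f
  proof (cases "\<exists>k. f k \<in> X")
    case True
    then obtain k where k: "f k \<in> X" by blast
    have inX: "f (n + k) \<in> X" for n
    proof (induction n)
      case (Suc n)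
      then show ?case using X conformsD(2,3)[OF f, of "n + k"] unfolding sas_region_def
        by (cases "f (n + k) \<in> V1") auto
    qed (simp add: k)
    have "conforms True \<tau>X X (\<lambda>n. f (n + k))"
      by (rule conforms_cong[OF conforms_shift[OF f]]) (use inX in auto)
    then have *: "(\<forall>\<^sub>\<infinity>n. \<Omega>1 (f (n + k)) = 0)" "fair (\<lambda>n. f (n + k)) \<longrightarrow> win True (\<lambda>n. f (n + k))"
      using X unfolding sas_region_def by blast+
    have "\<forall>\<^sub>\<infinity>n. \<Omega>1 (f n) = 0"
      using *(1) unfolding cofinite_eq_sequentially
      by (rule eventually_sequentially_seg[THEN iffD1])
    then show ?thesis using *(2) fair_shift[of f k] by (simp add: win_shift)
  next
    case False
    then have "conforms True \<tau> U f"
      by (intro conforms_cong[OF f]) (use conformsD(1)[OF f] disj in auto)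
    then show ?thesis by (rule U)
  qed
  moreover have "\<forall>x\<in>(X \<union> U) \<inter> V1. ?\<tau> x \<in> X \<union> U \<and> (x, ?\<tau> x) \<in> E"
    using X \<tau> unfolding sas_region_def by auto
  moreover have "\<forall>x\<in>(X \<union> U) - V1. \<forall>w. (x, w) \<in> E \<longrightarrow> w \<in> X \<union> U"
    using X closed unfolding sas_region_def by blast
  ultimately show ?thesis unfolding sas_region_def by simp
qed

lemma winning_in_maximal_sas_region:
  assumes \<sigma>1: "strategy E V1 \<sigma>1" and sure: "sure_winning E V1 v \<sigma>1 (Parity \<Omega>1)"
    and as: "as_winning V1 V2 E \<delta> v \<sigma>1 (Parity \<Omega>2)"
    and X: "sas_region X \<tau>X" and max: "\<And>Y \<tau>. sas_region Y \<tau> \<Longrightarrow> card Y \<le> card X"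
  shows "v \<in> X"
proof (rule ccontr)
  assume "v \<notin> X"
  have no_ext: "U = {}" if "X \<inter> U = {}" "sas_region (X \<union> U) \<tau>" for U \<tau>
    using max[OF that(2)] that(1) by (simp add: card_Un_disjoint)
  define Q where "Q h \<longleftrightarrow> consistent \<sigma>1 v h \<and> set h \<inter> X = {}" for h
  have Q_ne: "h \<noteq> []" if "Q h" for h using that by (simp add: Q_def consistent_def history_def)
  have "Q [v]" using \<open>v \<notin> X\<close> by (simp add: Q_def consistent_def history_def)
  have "\<exists>h. Q h \<and> (\<forall>g. g \<noteq> [] \<longrightarrow> Q (h @ g) \<longrightarrow> \<Omega>1 (last g) = 0)"
  proof (rule ccontr)
    assume "\<not> ?thesis"
    then have "\<exists>g. g \<noteq> [] \<and> Q (h @ g) \<and> \<Omega>1 (last g) \<noteq> 0" if "Q h" for h using that by blast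
    then obtain \<omega> where \<omega>: "\<forall>n. \<exists>m>n. Q (stake (Suc m) \<omega>) \<and> \<Omega>1 (\<omega> !! m) \<noteq> 0"
      using ex_stream_of_extensions[of Q "[v]" "\<lambda>u. \<Omega>1 u \<noteq> 0"] \<open>Q [v]\<close> by blast
    then have "\<omega> \<in> Out E V1 v \<sigma>1" unfolding Out_iff_consistent Q_def by blast
    then have "\<omega> \<in> Parity \<Omega>1" using sure unfolding sure_winning_def by blast
    then obtain n where n: "\<And>m. m > n \<Longrightarrow> \<Omega>1 (\<omega> !! m) = 0"
      unfolding Parity_coBuchi_iff MOST_nat by blast
    obtain m where "m > n" "\<Omega>1 (\<omega> !! m) \<noteq> 0" using \<omega> by blast
    then show False using n by simp
  qed
  then obtain h where Qh: "Q h" and good: "\<And>g. g \<noteq> [] \<Longrightarrow> Q (h @ g) \<Longrightarrow> \<Omega>1 (last g) = 0" by blast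
  \<comment> \<open>Only proper extensions count: \<open>last h\<close> itself may have priority 1,
    whereas \<open>good\<close> gives priority 0 on all of \<open>G\<close>.\<close>
  define G where "G = {last g | g. g \<noteq> [] \<and> Q (h @ g)}"
  have G0: "\<Omega>1 x = 0" if "x \<in> G" for x using that good unfolding G_def by auto
  have XG: "X \<inter> G = {}"
  proof -
    have "last g \<notin> X" if "g \<noteq> []" "Q (h @ g)" for g
    proof -
      have "set (h @ g) \<inter> X = {}" using that(2) unfolding Q_def by blast
      then show ?thesis using last_in_set[OF that(1)] by auto
    qed
    then show ?thesis unfolding G_def by auto
  qed
  have next_in: "w \<in> G \<union> X" if "Q (h @ g)" "(last (h @ g), w) \<in> E" "last (h @ g) \<in> V1 \<Longrightarrow> w = \<sigma>1 (h @ g)" for g w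
  proof (cases "w \<in> X")
    case False
    have "consistent \<sigma>1 v (h @ g @ [w])"
      using consistent_snoc[of \<sigma>1 v "h @ g" w] that unfolding Q_def by simp
    then have "Q (h @ g @ [w])" using that(1) False unfolding Q_def by simp
    then have "last (g @ [w]) \<in> G" unfolding G_def by blast
    then show ?thesis by simp
  qed simp
  have strat: "(last (h @ g), \<sigma>1 (h @ g)) \<in> E" if "Q (h @ g)" "last (h @ g) \<in> V1" for g
    using \<sigma>1 that unfolding strategy_def Q_def consistent_def by blast
  show False
  proof (cases "G = {}")
    case True
    have h: "last h \<notin> X" using Qh last_in_set[OF Q_ne[OF Qh]] unfolding Q_def by auto
    have \<sigma>h: "\<sigma>1 h \<in> X" "(last h, \<sigma>1 h) \<in> E" if "last h \<in> V1"
    proof -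
      show e: "(last h, \<sigma>1 h) \<in> E" using strat[of "[]"] Qh that by simp
      have "\<sigma>1 h \<in> G \<union> X" by (rule next_in[of "[]"]) (use Qh e in simp_all)
      then show "\<sigma>1 h \<in> X" using True by simp
    qed
    have "sas_region (X \<union> {last h}) (\<lambda>x. if x \<in> X then \<tau>X x else \<sigma>1 h)"
    proof (rule sas_region_extend[OF X])
      show "X \<inter> {last h} = {}" using h by simp
      show "\<forall>x\<in>{last h} \<inter> V1. \<sigma>1 h \<in> {last h} \<union> X \<and> (x, \<sigma>1 h) \<in> E"
        using \<sigma>h by auto
      have cl: "w \<in> X" if "last h \<notin> V1" "(last h, w) \<in> E" for w
        using next_in[of "[]" w] that Qh True by simp
      then show "\<forall>x\<in>{last h} - V1. \<forall>w. (x, w) \<in> E \<longrightarrow> w \<in> {last h} \<union> X" by blast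
      \<comment> \<open>Every step from \<open>last h\<close> leads into \<open>X\<close>, so no
        play is confined to \<open>{last h}\<close> and the claim is vacuous.\<close>
      fix f
      assume f: "conforms True (\<lambda>x. \<sigma>1 h) {last h} f"
      have "f 0 = last h" "f 1 = last h" using conformsD(1)[OF f] by auto
      moreover have "f 1 \<in> X"
      proof (cases "last h \<in> V1")
        case True
        then have "f 1 = \<sigma>1 h" using conformsD(3)[OF f, of 0] \<open>f 0 = last h\<close> by simp
        then show ?thesis using \<sigma>h(1)[OF True] by (simp only:)
      next
        case False
        then show ?thesis using cl conformsD(2)[OF f, of 0] \<open>f 0 = last h\<close> by simp
      qed
      ultimately show "(\<forall>\<^sub>\<infinity>n. \<Omega>1 (f n) = 0) \<and> (fair f \<longrightarrow> win True f)" using h by simp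
    qed
    then show False using no_ext[of "{last h}"] h by blast
  next
    case False
    have succ: "\<forall>x\<in>G. \<exists>w\<in>G \<union> X. (x, w) \<in> E"
    proof
      fix x
      assume "x \<in> G"
      then obtain g where g: "g \<noteq> []" "Q (h @ g)" "x = last (h @ g)" unfolding G_def by auto
      obtain w where w: "(last (h @ g), w) \<in> E" using ex_succ by blast
      show "\<exists>w\<in>G \<union> X. (x, w) \<in> E"
        using next_in[OF g(2), of "\<sigma>1 (h @ g)"] next_in[OF g(2) w] strat[OF g(2)] w g(3) by blast
    qed
    have closed: "\<forall>x\<in>G - V1. \<forall>w. (x, w) \<in> E \<longrightarrow> w \<in> G \<union> X"
    proof (intro ballI allI impI)
      fix x w
      assume "x \<in> G - V1" "(x, w) \<in> E"
      moreover from this obtain g where "g \<noteq> []" "Q (h @ g)" "x = last (h @ g)" unfolding G_def by auto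
      ultimately show "w \<in> G \<union> X" using next_in[of g w] by blast
    qed
    \<comment> \<open>\<open>X\<close> serves as the absorbing target.\<close>
    from region_or_opponent_region[OF XG succ] closed
    consider \<tau> where "\<forall>x\<in>G \<inter> V1. \<tau> x \<in> G \<union> X \<and> (x, \<tau> x) \<in> E"
        "\<forall>f. conforms True \<tau> G f \<longrightarrow> fair f \<longrightarrow> win True f"
      | U \<tau> where "U \<noteq> {}" "region False (G \<union> X) U \<tau>" "U \<subseteq> G"
      by auto
    then show False
    proof cases
      case (1 \<tau>)
      have "sas_region (X \<union> G) (\<lambda>x. if x \<in> X then \<tau>X x else \<tau> x)"
      proof (rule sas_region_extend[OF X XG 1(1) closed])
        fix f
        assume f: "conforms True \<tau> G f"
        show "(\<forall>\<^sub>\<infinity>n. \<Omega>1 (f n) = 0) \<and> (fair f \<longrightarrow> win True f)"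
          using 1(2) f G0 conformsD(1)[OF f] by simp
      qed
      then show False using no_ext[OF XG] False by blast
    next
      case (2 U \<tau>)
      obtain u where "u \<in> U" using 2(1) by blast
      then obtain g where g: "g \<noteq> []" "Q (h @ g)" "last (h @ g) \<in> U"
        using 2(3) unfolding G_def by (auto dest: subsetD)
      have reg: "\<forall>x\<in>U \<inter> V2. \<tau> x \<in> U \<and> (x, \<tau> x) \<in> E"
        "\<forall>x\<in>U - V2. \<forall>w\<in>G \<union> X. (x, w) \<in> E \<longrightarrow> w \<in> U"
        "\<And>f. conforms False \<tau> U f \<Longrightarrow> fair f \<Longrightarrow> win False f"
        using 2(2) unfolding region_def by simp_all
      show False
      proof (rule no_opponent_region[OF \<sigma>1 as _ g(3) reg(1,3)])
        show "consistent \<sigma>1 v (h @ g)" using g(2) by (simp add: Q_def)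
        fix g' w
        assume c: "consistent \<sigma>1 v ((h @ g) @ g' @ [w])" and g': "set g' \<subseteq> U"
          and last: "last ((h @ g) @ g') \<in> U - V2"
        \<comment> \<open>Unless \<open>w\<close> is in \<open>X\<close>, the longer history still
          avoids \<open>X\<close> and properly extends \<open>h\<close>, so it ends in
          \<open>G\<close>. Then the trap property of \<open>U\<close> applies.\<close>
        have "w \<in> G \<union> X"
        proof (cases "w \<in> X")
          case wX: False
          have "set g' \<inter> X = {}" using g' 2(3) XG by blast
          then have "Q (h @ (g @ g' @ [w]))" using c g(2) wX unfolding Q_def by auto
          then have "last (g @ g' @ [w]) \<in> G" unfolding G_def by blast
          then show ?thesis by simp
        qed simp
        moreover have "(last ((h @ g) @ g'), w) \<in> E"
          by (rule consistent_last_step) (use c g(1) in simp_all)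
        ultimately show "w \<in> U" using reg(2) last by blast
      qed
    qed
  qed
qed

end

theorem theorem7:
  fixes V1 V2 VP :: "'v::finite set" and E :: "('v \<times> 'v) set" and \<delta> :: "'v \<Rightarrow> 'v pmf"
    and \<Omega>1 \<Omega>2 :: "'v \<Rightarrow> nat" and v :: 'v and \<sigma>1 :: "'v list \<Rightarrow> 'v"
  assumes "stoch_game V1 V2 VP E \<delta>"
    and "\<forall>u. \<Omega>1 u \<le> 1"
    and "strategy E V1 \<sigma>1"
    and "sure_winning E V1 v \<sigma>1 (Parity \<Omega>1)"
    and "as_winning V1 V2 E \<delta> v \<sigma>1 (Parity \<Omega>2)"
  shows "\<exists>\<sigma>. strategy E V1 \<sigma> \<and> memoryless E V1 \<sigma> \<and>
             sure_winning E V1 v \<sigma> (Parity \<Omega>1) \<and> as_winning V1 V2 E \<delta> v \<sigma> (Parity \<Omega>2)"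
proof -
  interpret sas_game V1 V2 VP E \<delta> \<Omega>1 \<Omega>2
    using assms(1,2) by unfold_locales auto
  \<comment> \<open>The empty region starts the search for one of greatest cardinality.\<close>
  have "\<exists>\<tau>. sas_region {} \<tau>" unfolding sas_region_def conforms_def by simp
  from ex_max_card[of "\<lambda>X. \<exists>\<tau>. sas_region X \<tau>", OF this]
  obtain X \<tau> where X: "sas_region X \<tau>" and max: "\<And>Y \<tau>. sas_region Y \<tau> \<Longrightarrow> card Y \<le> card X"
    by blast
  have "v \<in> X" by (rule winning_in_maximal_sas_region[OF assms(3-5) X max])
  then show ?thesis by (rule sas_region_memoryless[OF X])
qed

end
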